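(* There exists an absolute constant $c>0$ such that for every $n\ge 1$, every ellipsoid $E$ in $\mathbf{R}^n$ and every $\theta\in(0,1)$ there exists $\sigma\subseteq\{1,\ldots,n\}$ with $|\sigma|=[(1-\theta)n]$ for which $$|\mathcal{P}_{\sigma}(E)\cap\mathbf{Z}^{\sigma}|\ \ge\ d\left(\frac{c\sqrt\theta}{\sqrt{\log(\frac2\theta)}\,M_E},[(1-\theta)n]\right)\ \ge\ \binom{[(1-\theta)n]}{\left[\frac{c^2\theta}{\log(\frac2\theta)M_E^2}\right]}\,2^{\left[\frac{c^2\theta}{\log(\frac2\theta)M_E^2}\right]}.$$
   Context: $\mathbf{R}^n$ is equipped with the standard Euclidean structure with orthonormal basis $\{e_j\}$, unit ball $D_n$ and unit sphere $S^{n-1}$. Ellipsoids are non-degenerate and origin-centred. $M_E=\left(\int_{S^{n-1}}\|x\|_E^2\,d\mu(x)\right)^{1/2}$, where $\|\cdot\|_E$ is the norm with unit ball $E$ and $\mu$ is the rotationally invariant probability measure on $S^{n-1}$. For $\sigma\subseteq\{1,\ldots,n\}$, $\mathbf{R}^{\sigma}=\{x:\langle x,e_j\rangle=0\text{ if }j\notin\sigma\}$, $\mathbf{Z}^{\sigma}=\mathbf{Z}^n\cap\mathbf{R}^{\sigma}$, and $\mathcal{P}_{\sigma}$ is the orthogonal projection onto $\mathbf{R}^{\sigma}$. $|A|$ denotes the cardinality of a finite set $A$, $[\cdot]$ the integer part, and $d(t,m)=|tD_m\cap\mathbf{Z}^m|$ is the number of integer points in the $m$-dimensional Euclidean ball of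 radius $t$. Binomial coefficients $\binom{a}{b}$ with $b>a$ are $0$. *)

theory Defs
  imports "HOL-Probability.Probability"
begin

text \<open>
  The dimension is quantified inside the statement (the constant must not depend on it), so
  Euclidean n-space is not rendered by a type: it is the set of all sequences
  \<open>x :: nat \<Rightarrow> real\<close> supported in \<open>{1..n}\<close>, and the Euclidean norm of \<open>x\<close> is
  \<open>L2_set x {1..n}\<close>.
\<close>

definition Rsub :: "nat set \<Rightarrow> (nat \<Rightarrow> real) set" where
  "Rsub \<sigma> = {x. \<forall>j. j \<notin> \<sigma> \<longrightarrow> x j = 0}"

definition Zsub :: "nat set \<Rightarrow> (nat \<Rightarrow> real) set" where
  "Zsub \<sigma> = {x \<in> Rsub \<sigma>. \<forall>j. x j \<in> \<int>}"

abbreviation Rn :: "nat \<Rightarrow> (nat \<Rightarrow> real) set" where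
  "Rn n \<equiv> Rsub {1..n}"

abbreviation Zn :: "nat \<Rightarrow> (nat \<Rightarrow> real) set" where
  "Zn n \<equiv> Zsub {1..n}"

definition unit_ball :: "nat \<Rightarrow> (nat \<Rightarrow> real) set" where
  "unit_ball n = {x \<in> Rn n. L2_set x {1..n} \<le> 1}"

definition unit_sphere :: "nat \<Rightarrow> (nat \<Rightarrow> real) set" where
  "unit_sphere n = {x \<in> Rn n. L2_set x {1..n} = 1}"

definition dilate :: "real \<Rightarrow> (nat \<Rightarrow> real) set \<Rightarrow> (nat \<Rightarrow> real) set" where
  "dilate t A = (\<lambda>x j. t * x j) ` A"

definition coord_proj :: "nat set \<Rightarrow> (nat \<Rightarrow> real) \<Rightarrow> (nat \<Rightarrow> real)" where
  "coord_proj \<sigma> x = (\<lambda>j. if j \<in> \<sigma> then x j else 0)"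

text \<open>The linear map of n-space with matrix \<open>a\<close>.\<close>

definition lin :: "nat \<Rightarrow> (nat \<Rightarrow> nat \<Rightarrow> real) \<Rightarrow> (nat \<Rightarrow> real) \<Rightarrow> (nat \<Rightarrow> real)" where
  "lin n a x = (\<lambda>i. if i \<in> {1..n} then \<Sum>j=1..n. a i j * x j else 0)"

definition ellipsoid :: "nat \<Rightarrow> (nat \<Rightarrow> real) set \<Rightarrow> bool" where
  "ellipsoid n E \<longleftrightarrow>
     (\<exists>a. bij_betw (lin n a) (Rn n) (Rn n) \<and> E = lin n a ` unit_ball n)"

text \<open>The norm with unit ball \<open>E\<close> (Minkowski functional).\<close>

definition gauge_norm :: "(nat \<Rightarrow> real) set \<Rightarrow> (nat \<Rightarrow> real) \<Rightarrow> real" where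
  "gauge_norm E x = Inf {t. 0 < t \<and> x \<in> dilate t E}"

definition orthogonal_map :: "nat \<Rightarrow> (nat \<Rightarrow> nat \<Rightarrow> real) \<Rightarrow> bool" where
  "orthogonal_map n a \<longleftrightarrow>
     bij_betw (lin n a) (Rn n) (Rn n) \<and>
     (\<forall>x \<in> Rn n. L2_set (lin n a x) {1..n} = L2_set x {1..n})"

text \<open>
  Invariance is under the full orthogonal group, so that the measure is also unique for \<open>n = 1\<close>.
  The Borel sets of \<open>nat \<Rightarrow> real\<close> are those of the product topology, which induces the
  Euclidean topology on n-space.
\<close>

definition rotation_invariant_prob :: "nat \<Rightarrow> (nat \<Rightarrow> real) measure \<Rightarrow> bool" where
  "rotation_invariant_prob n \<mu> \<longleftrightarrow>
     prob_space \<mu> \<and> sets \<mu> = sets (restrict_space borel (unit_sphere n)) \<and>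
     (\<forall>a. orthogonal_map n a \<longrightarrow> distr \<mu> \<mu> (lin n a) = \<mu>)"

text \<open>
  For \<open>n \<ge> 1\<close> existence is lemma \<open>rotation_invariant_prob_sphere_measure\<close> below;
  uniqueness is classical and is not needed for the choice to be well defined.
\<close>

definition sphere_measure :: "nat \<Rightarrow> (nat \<Rightarrow> real) measure" where
  "sphere_measure n = (SOME \<mu>. rotation_invariant_prob n \<mu>)"

definition M_ell :: "nat \<Rightarrow> (nat \<Rightarrow> real) set \<Rightarrow> real" where
  "M_ell n E = sqrt (\<integral>x. (gauge_norm E x)\<^sup>2 \<partial>(sphere_measure n))"

definition d_count :: "real \<Rightarrow> nat \<Rightarrow> nat" where
  "d_count t m = card (dilate t (unit_ball m) \<inter> Zn m)"


subsection \<open>Existence of the rotation invariant probability measure\<close>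

context
  notes One_nat_def [simp del]
begin

definition leb :: "nat \<Rightarrow> (nat \<Rightarrow> real) measure" where
  "leb n = distr (PiM {1..n} (\<lambda>_. lborel)) borel (coord_proj {1..n})"

definition affine_coord :: "nat \<Rightarrow> real \<Rightarrow> (nat \<Rightarrow> real) \<Rightarrow> (nat \<Rightarrow> real) \<Rightarrow> (nat \<Rightarrow> real)" where
  "affine_coord n s v y = (\<lambda>i. if i \<in> {1..n} then v i + s * y i else 0)"

definition shell :: "nat \<Rightarrow> (nat \<Rightarrow> real) set" where
  "shell n = {x. 1 \<le> L2_set x {1..n} \<and> L2_set x {1..n} \<le> 2 * real n}"

definition radial :: "nat \<Rightarrow> (nat \<Rightarrow> real) \<Rightarrow> (nat \<Rightarrow> real)" where
  "radial n x = (\<lambda>i. if i \<in> {1..n} then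
      (if L2_set x {1..n} = 0 then (if i = 1 then 1 else 0) else x i / L2_set x {1..n}) else 0)"

lemma measurable_coord [measurable]:
  "(\<lambda>x. x i) \<in> borel_measurable (borel :: (nat \<Rightarrow> real) measure)"
  using borel_measurable_continuous_onI[OF continuous_on_product_coordinates] by simp

lemma measurable_coord_pair [measurable]:
  "(\<lambda>p. fst p i) \<in> borel_measurable ((borel :: (nat \<Rightarrow> real) measure) \<Otimes>\<^sub>M M)"
  "(\<lambda>p. snd p i) \<in> borel_measurable (M \<Otimes>\<^sub>M (borel :: (nat \<Rightarrow> real) measure))"
  by (auto intro: measurable_compose[OF measurable_fst measurable_coord]
    measurable_compose[OF measurable_snd measurable_coord])

lemma measurable_into_seq:
  fixes f :: "'a \<Rightarrow> nat \<Rightarrow> real"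
  assumes "\<And>i. (\<lambda>x. f x i) \<in> borel_measurable M"
  shows "f \<in> M \<rightarrow>\<^sub>M borel"
  using assms by (rule measurable_coordinatewise_then_product)

lemma measurable_L2 [measurable]:
  "(\<lambda>x. L2_set x {1..n}) \<in> borel_measurable (borel :: (nat \<Rightarrow> real) measure)"
  unfolding L2_set_def by measurable

lemma measurable_lin [measurable]: "lin n a \<in> borel \<rightarrow>\<^sub>M borel"
  by (rule measurable_into_seq) (simp add: lin_def)

lemma measurable_radial [measurable]: "radial n \<in> borel \<rightarrow>\<^sub>M borel"
proof (rule measurable_into_seq)
  fix i
  show "(\<lambda>x. radial n x i) \<in> borel_measurable borel"
  proof (cases "i \<in> {1..n}")
    case True
    then show ?thesis unfolding radial_def by (simp only: if_True) measurable
  next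
    case False
    then show ?thesis unfolding radial_def by (simp only: if_False) measurable
  qed
qed

lemma measurable_affine_coord [measurable]: "affine_coord n s v \<in> borel \<rightarrow>\<^sub>M borel"
  by (rule measurable_into_seq) (simp add: affine_coord_def)

lemma measurable_proj_PiM [measurable]:
  "coord_proj {1..n} \<in> PiM {1..n} (\<lambda>_. lborel) \<rightarrow>\<^sub>M borel"
proof (rule measurable_into_seq)
  fix i
  show "(\<lambda>x. coord_proj {1..n} x i) \<in> borel_measurable (PiM {1..n} (\<lambda>_. lborel))"
  proof (cases "i \<in> {1..n}")
    case True
    then have "(\<lambda>x. x i) \<in> PiM {1..n} (\<lambda>_. lborel) \<rightarrow>\<^sub>M (lborel :: real measure)"
      by (rule measurable_component_singleton)
    with True show ?thesis by (simp add: coord_proj_def)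
  qed (simp add: coord_proj_def del: atLeastAtMost_iff)
qed

lemma sets_leb [measurable_cong, simp]: "sets (leb n) = sets borel"
  by (simp add: leb_def)

lemma space_leb [simp]: "space (leb n) = UNIV"
  by (simp add: leb_def)

lemma sets_unit_sphere [measurable]: "unit_sphere n \<in> sets borel"
proof -
  have "unit_sphere n = (\<Inter>j. {x. j \<in> {1..n} \<or> x j = 0}) \<inter> {x. L2_set x {1..n} = 1}"
    by (auto simp: unit_sphere_def Rsub_def)
  moreover have "{x :: nat \<Rightarrow> real. j \<in> {1..n} \<or> x j = 0} \<in> sets borel" for j
    by measurable
  moreover have "{x. L2_set x {1..n} = 1} \<in> sets borel" by measurable
  ultimately show ?thesis
    by (simp only:) (intro sets.Int sets.countable_INT'', simp_all)
qed

lemma sets_shell [measurable]: "shell n \<in> sets borel"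
  unfolding shell_def by measurable

lemma lborel_affine_sign:
  assumes "s = 1 \<or> s = (-1::real)"
  shows "distr lborel borel (\<lambda>x. t + s * x) = (lborel :: real measure)"
proof -
  have "lborel = density (distr lborel borel (\<lambda>x. t + s * x)) (\<lambda>_. ennreal \<bar>s\<bar>)"
    using assms by (intro lborel_real_affine) auto
  also have "(\<lambda>_::real. ennreal \<bar>s\<bar>) = (\<lambda>_. 1)" using assms by auto
  finally show ?thesis by (simp add: density_1)
qed

lemma leb_affine:
  assumes s: "s = 1 \<or> s = (-1::real)"
  shows "distr (leb n) borel (affine_coord n s v) = leb n"
proof -
  interpret product_sigma_finite "\<lambda>_::nat. lborel :: real measure" by standard
  let ?N = "PiM {1..n} (\<lambda>_. lborel :: real measure)"
  let ?g = "\<lambda>y. \<lambda>i\<in>{1..n}. v i + s * y i"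
  have g [measurable]: "?g \<in> ?N \<rightarrow>\<^sub>M ?N"
    by (rule measurable_restrict) measurable
  have N: "distr ?N ?N ?g = ?N"
  proof (rule PiM_eqI)
    fix A :: "nat \<Rightarrow> real set" assume A: "\<And>i. i \<in> {1..n} \<Longrightarrow> A i \<in> sets lborel"
    have meas: "Pi\<^sub>E {1..n} A \<in> sets ?N" using A by (intro sets_PiM_I_finite) auto
    have vim: "?g -` Pi\<^sub>E {1..n} A \<inter> space ?N = Pi\<^sub>E {1..n} (\<lambda>i. (\<lambda>x. v i + s * x) -` A i)"
      by (auto simp: space_PiM PiE_iff)
    have vm: "(\<lambda>x. v i + s * x) -` A i \<in> sets lborel" if "i \<in> {1..n}" for i
    proof -
      have "(\<lambda>x. v i + s * x) \<in> (lborel :: real measure) \<rightarrow>\<^sub>M lborel" by measurable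
      from measurable_sets[OF this A[OF that]] show ?thesis by simp
    qed
    have e: "emeasure lborel ((\<lambda>x. v i + s * x) -` A i) = emeasure lborel (A i)"
      if "i \<in> {1..n}" for i
    proof -
      have "emeasure lborel (A i) = emeasure (distr lborel borel (\<lambda>x. v i + s * x)) (A i)"
        by (simp only: lborel_affine_sign[OF s])
      also have "\<dots> = emeasure lborel ((\<lambda>x. v i + s * x) -` A i)"
        using A[OF that] by (subst emeasure_distr) auto
      finally show ?thesis by simp
    qed
    have "emeasure (distr ?N ?N ?g) (Pi\<^sub>E {1..n} A)
        = emeasure ?N (Pi\<^sub>E {1..n} (\<lambda>i. (\<lambda>x. v i + s * x) -` A i))"
      using meas by (simp only: emeasure_distr[OF g] vim)
    also have "\<dots> = (\<Prod>i\<in>{1..n}. emeasure lborel ((\<lambda>x. v i + s * x) -` A i))"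
      using vm by (intro emeasure_PiM) auto
    also have "\<dots> = (\<Prod>i\<in>{1..n}. emeasure lborel (A i))"
      by (intro prod.cong refl e)
    finally show "emeasure (distr ?N ?N ?g) (Pi\<^sub>E {1..n} A) = (\<Prod>i\<in>{1..n}. emeasure lborel (A i))" .
  qed auto
  have "distr (leb n) borel (affine_coord n s v) = distr ?N borel (affine_coord n s v \<circ> coord_proj {1..n})"
    unfolding leb_def by (rule distr_distr) measurable
  also have "affine_coord n s v \<circ> coord_proj {1..n} = coord_proj {1..n} \<circ> ?g"
    by (auto simp: affine_coord_def coord_proj_def fun_eq_iff)
  also have "distr ?N borel (coord_proj {1..n} \<circ> ?g) = distr (distr ?N ?N ?g) borel (coord_proj {1..n})"
    by (rule distr_distr[symmetric]) measurable
  also have "\<dots> = leb n" unfolding N leb_def ..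
  finally show ?thesis .
qed

lemma leb_affine_nn:
  assumes "s = 1 \<or> s = (-1::real)" and [measurable]: "f \<in> borel_measurable borel"
  shows "(\<integral>\<^sup>+y. f (affine_coord n s v y) \<partial>leb n) = (\<integral>\<^sup>+y. f y \<partial>leb n)"
proof -
  have "(\<integral>\<^sup>+y. f y \<partial>leb n) = (\<integral>\<^sup>+y. f y \<partial>(distr (leb n) borel (affine_coord n s v)))"
    by (simp only: leb_affine[OF assms(1)])
  also have "\<dots> = (\<integral>\<^sup>+y. f (affine_coord n s v y) \<partial>leb n)"
    by (rule nn_integral_distr) measurable
  finally show ?thesis by simp
qed

lemma emeasure_leb:
  assumes "A \<in> sets borel"
  shows "emeasure (leb n) A
    = emeasure (PiM {1..n} (\<lambda>_. lborel)) (coord_proj {1..n} -` A \<inter> space (PiM {1..n} (\<lambda>_. lborel)))"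
  unfolding leb_def using assms by (intro emeasure_distr) auto

lemma emeasure_leb_box:
  assumes "A \<in> sets borel" "b \<le> c"
    and "\<And>x. (\<And>i. i \<in> {1..n} \<Longrightarrow> b \<le> x i \<and> x i \<le> c) \<Longrightarrow> coord_proj {1..n} x \<in> A"
  shows "ennreal (c - b) ^ n \<le> emeasure (leb n) A"
proof -
  interpret product_sigma_finite "\<lambda>_::nat. lborel :: real measure" by standard
  have "ennreal (c - b) ^ n = emeasure (PiM {1..n} (\<lambda>_. lborel)) (Pi\<^sub>E {1..n} (\<lambda>_. {b..c}))"
    using assms(2) by (subst emeasure_PiM) auto
  also have "\<dots> \<le> emeasure (PiM {1..n} (\<lambda>_. lborel))
      (coord_proj {1..n} -` A \<inter> space (PiM {1..n} (\<lambda>_. lborel)))"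
  proof (rule emeasure_mono)
    show "Pi\<^sub>E {1..n} (\<lambda>_. {b..c}) \<subseteq> coord_proj {1..n} -` A \<inter> space (PiM {1..n} (\<lambda>_. lborel))"
      using assms(3) by (fastforce simp: space_PiM PiE_iff)
    show "coord_proj {1..n} -` A \<inter> space (PiM {1..n} (\<lambda>_. lborel)) \<in> sets (PiM {1..n} (\<lambda>_. lborel))"
      using assms(1) by measurable
  qed
  finally show ?thesis using emeasure_leb[OF assms(1)] by simp
qed

lemma emeasure_leb_finite:
  assumes "A \<in> sets borel" and "\<And>x i. x \<in> A \<Longrightarrow> i \<in> {1..n} \<Longrightarrow> \<bar>x i\<bar> \<le> c"
  shows "emeasure (leb n) A < \<infinity>"
proof -
  interpret product_sigma_finite "\<lambda>_::nat. lborel :: real measure" by standard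
  have "emeasure (leb n) A \<le> emeasure (PiM {1..n} (\<lambda>_. lborel)) (Pi\<^sub>E {1..n} (\<lambda>_. {-c..c}))"
    unfolding emeasure_leb[OF assms(1)]
  proof (rule emeasure_mono)
    show "coord_proj {1..n} -` A \<inter> space (PiM {1..n} (\<lambda>_. lborel)) \<subseteq> Pi\<^sub>E {1..n} (\<lambda>_. {-c..c})"
    proof
      fix x :: "nat \<Rightarrow> real"
      assume x: "x \<in> coord_proj {1..n} -` A \<inter> space (PiM {1..n} (\<lambda>_. lborel))"
      have "\<bar>x i\<bar> \<le> c" if "i \<in> {1..n}" for i
        using assms(2)[of "coord_proj {1..n} x" i] x that by (auto simp: coord_proj_def)
      with x show "x \<in> Pi\<^sub>E {1..n} (\<lambda>_. {-c..c})"
        unfolding space_PiM PiE_iff by (simp add: abs_le_iff minus_le_iff del: atLeastAtMost_iff)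
          (simp add: minus_le_iff PiE_def)
    qed
    show "Pi\<^sub>E {1..n} (\<lambda>_. {-c..c}) \<in> sets (PiM {1..n} (\<lambda>_. lborel))"
      by (intro sets_PiM_I_finite) auto
  qed
  also have "\<dots> = (\<Prod>i\<in>{1..n}. emeasure lborel {-c..c})"
    by (rule emeasure_PiM) auto
  also have "\<dots> < \<infinity>"
    by (simp add: less_top[symmetric] power_eq_top_ennreal emeasure_lborel_Icc_eq)
  finally show ?thesis .
qed

lemma abs_le_L2_set: "i \<in> {1..n} \<Longrightarrow> \<bar>x i\<bar> \<le> L2_set x {1..n}"
  for x :: "nat \<Rightarrow> real"
  using member_le_L2_set[of "{1..n}" i "\<lambda>i. \<bar>x i\<bar>"] by (simp add: L2_set_def)

lemma sigma_finite_leb: "sigma_finite_measure (leb n)"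
proof
  let ?C = "\<lambda>k::nat. {x :: nat \<Rightarrow> real. L2_set x {1..n} \<le> real k}"
  have "?C k \<in> sets borel" for k by measurable
  moreover have "emeasure (leb n) (?C k) \<noteq> \<infinity>" for k
  proof -
    have "emeasure (leb n) (?C k) < \<infinity>"
    proof (rule emeasure_leb_finite)
      show "\<bar>x i\<bar> \<le> real k" if "x \<in> ?C k" "i \<in> {1..n}" for x i
        using abs_le_L2_set[OF that(2), of x] that(1) by simp
    qed measurable
    then show ?thesis by simp
  qed
  moreover have "(\<Union>k. ?C k) = UNIV" by (auto intro: real_arch_simple)
  ultimately show "\<exists>A. countable A \<and> A \<subseteq> sets (leb n) \<and> \<Union> A = space (leb n) \<and>
      (\<forall>a\<in>A. emeasure (leb n) a \<noteq> \<infinity>)"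
    by (intro exI[of _ "range ?C"] conjI) (simp_all add: image_subset_iff)
qed

lemma shell_finite: "emeasure (leb n) (shell n) < \<infinity>"
proof (rule emeasure_leb_finite)
  show "\<bar>x i\<bar> \<le> 2 * real n" if "x \<in> shell n" "i \<in> {1..n}" for x i
    using abs_le_L2_set[OF that(2), of x] that(1) by (simp add: shell_def)
qed measurable

lemma shell_pos:
  assumes "n \<ge> 1"
  shows "emeasure (leb n) (shell n) \<noteq> 0"
proof -
  have "ennreal (2 - 1) ^ n \<le> emeasure (leb n) (shell n)"
  proof (rule emeasure_leb_box)
    fix x :: "nat \<Rightarrow> real"
    assume x: "\<And>i. i \<in> {1..n} \<Longrightarrow> 1 \<le> x i \<and> x i \<le> 2"
    have L: "L2_set (coord_proj {1..n} x) {1..n} = sqrt (\<Sum>i=1..n. (x i)\<^sup>2)"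
      by (simp add: L2_set_def coord_proj_def)
    have "(\<Sum>i=1..n. (1::real)) \<le> (\<Sum>i=1..n. (x i)\<^sup>2)"
      by (rule sum_mono) (use x in \<open>simp add: one_le_power\<close>)
    then have 1: "1 \<le> sqrt (\<Sum>i=1..n. (x i)\<^sup>2)" using assms by simp
    have "(\<Sum>i=1..n. (x i)\<^sup>2) \<le> (\<Sum>i=1..n. (2::real)\<^sup>2)"
      by (rule sum_mono, rule power_mono) (use x in force)+
    also have "\<dots> = 4 * real n" by simp
    also have "\<dots> \<le> 4 * (real n * real n)" using assms by simp
    also have "\<dots> = (2 * real n)\<^sup>2" by (simp add: power2_eq_square)
    finally have "sqrt (\<Sum>i=1..n. (x i)\<^sup>2) \<le> 2 * real n" by (intro real_le_lsqrt) auto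
    with 1 show "coord_proj {1..n} x \<in> shell n" by (simp add: shell_def L)
  qed auto
  then show ?thesis by auto
qed

lemma lin_cong: "(\<And>j. j \<in> {1..n} \<Longrightarrow> x j = y j) \<Longrightarrow> lin n a x = lin n a y"
  by (simp add: lin_def fun_eq_iff)

lemma coord_proj_Rn: "coord_proj {1..n} x \<in> Rn n"
  by (simp add: coord_proj_def Rsub_def)

lemma lin_proj: "lin n a (coord_proj {1..n} x) = lin n a x"
  by (rule lin_cong) (simp add: coord_proj_def)

lemma lin_Rn: "lin n a x \<in> Rn n"
  by (auto simp: lin_def Rsub_def)

lemma orthogonal_L2:
  assumes "orthogonal_map n a"
  shows "L2_set (lin n a x) {1..n} = L2_set x {1..n}"
proof -
  have "L2_set (lin n a (coord_proj {1..n} x)) {1..n} = L2_set (coord_proj {1..n} x) {1..n}"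
    using assms coord_proj_Rn unfolding orthogonal_map_def by blast
  then show ?thesis by (simp only: lin_proj) (simp add: L2_set_def coord_proj_def)
qed

lemma leb_lin_aux:
  assumes bij: "bij_betw (lin n a) (Rn n) (Rn n)"
    and A [measurable]: "A \<in> sets borel" and B [measurable]: "B \<in> sets borel"
  shows "emeasure (leb n) (lin n a -` A) * emeasure (leb n) B
       = emeasure (leb n) A * emeasure (leb n) (lin n a -` B)"
proof -
  interpret L: sigma_finite_measure "leb n" by (rule sigma_finite_leb)
  interpret P: pair_sigma_finite "leb n" "leb n" ..
  let ?U = "lin n a"
  let ?iA = "indicator A :: _ \<Rightarrow> ennreal" and ?iB = "indicator B :: _ \<Rightarrow> ennreal"
  have vA: "?U -` A \<in> sets (leb n)" and vB: "?U -` B \<in> sets (leb n)"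
    using measurable_sets[OF measurable_lin[of n a] A] measurable_sets[OF measurable_lin[of n a] B]
    by auto
  have aff [measurable]:
    "(\<lambda>p. affine_coord n s (?U (fst p)) (snd p)) \<in> borel \<Otimes>\<^sub>M borel \<rightarrow>\<^sub>M borel" for s
    by (rule measurable_into_seq) (simp add: affine_coord_def lin_def)
  have aff' [measurable]:
    "(\<lambda>(x,y). affine_coord n s (?U x) y) \<in> borel \<Otimes>\<^sub>M borel \<rightarrow>\<^sub>M borel" for s
    using aff by (simp add: case_prod_beta')
  have eA: "emeasure (leb n) (?U -` A) = (\<integral>\<^sup>+x. ?iA (?U x) \<partial>leb n)"
    and eB: "emeasure (leb n) (?U -` B) = (\<integral>\<^sup>+x. ?iB (?U x) \<partial>leb n)"
    using nn_integral_indicator[OF vA] nn_integral_indicator[OF vB]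
    by (simp_all add: indicator_vimage comp_def)
  have "emeasure (leb n) (?U -` A) * emeasure (leb n) B
      = (\<integral>\<^sup>+x. ?iA (?U x) * emeasure (leb n) B \<partial>leb n)"
    unfolding eA by (rule nn_integral_multc[symmetric]) measurable
  also have "\<dots> = (\<integral>\<^sup>+x. \<integral>\<^sup>+y. ?iA (?U x) * ?iB (affine_coord n 1 (?U x) y) \<partial>leb n \<partial>leb n)"
  proof (rule nn_integral_cong)
    fix x
    have "?iA (?U x) * emeasure (leb n) B = ?iA (?U x) * (\<integral>\<^sup>+y. ?iB y \<partial>leb n)" by simp
    also have "\<dots> = ?iA (?U x) * (\<integral>\<^sup>+y. ?iB (affine_coord n 1 (?U x) y) \<partial>leb n)"
      by (subst leb_affine_nn) auto
    also have "\<dots> = (\<integral>\<^sup>+y. ?iA (?U x) * ?iB (affine_coord n 1 (?U x) y) \<partial>leb n)"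
      by (rule nn_integral_cmult[symmetric]) measurable
    finally show "?iA (?U x) * emeasure (leb n) B
      = (\<integral>\<^sup>+y. ?iA (?U x) * ?iB (affine_coord n 1 (?U x) y) \<partial>leb n)" .
  qed
  also have "\<dots> = (\<integral>\<^sup>+y. \<integral>\<^sup>+x. ?iA (?U x) * ?iB (affine_coord n 1 (?U x) y) \<partial>leb n \<partial>leb n)"
    by (rule P.Fubini'[symmetric]) measurable
  also have "\<dots> = (\<integral>\<^sup>+y. \<integral>\<^sup>+x. ?iA (affine_coord n (-1) (?U x) y) * ?iB (?U x) \<partial>leb n \<partial>leb n)"
  proof (rule nn_integral_cong)
    fix y
    obtain z where z: "z \<in> Rn n" "?U z = coord_proj {1..n} y"
      using bij coord_proj_Rn[of n y] unfolding bij_betw_def by (metis imageE)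
    have Ush: "?U (affine_coord n 1 (\<lambda>i. - z i) x) i = ?U x i - y i" if "i \<in> {1..n}" for x i
    proof -
      have "?U (affine_coord n 1 (\<lambda>i. - z i) x) i = ?U x i - ?U z i"
        using that by (simp add: lin_def affine_coord_def algebra_simps sum_subtractf sum_negf
          flip: sum.distrib)
      then show ?thesis using z(2) that by (simp add: coord_proj_def)
    qed
    have 1: "?U (affine_coord n 1 (\<lambda>i. - z i) x) = affine_coord n (-1) (?U x) y" for x
      using Ush lin_Rn[of n a] by (auto simp: affine_coord_def fun_eq_iff Rsub_def)
    have 2: "affine_coord n 1 (?U (affine_coord n 1 (\<lambda>i. - z i) x)) y = ?U x" for x
      unfolding 1 using lin_Rn[of n a x] by (auto simp: affine_coord_def fun_eq_iff Rsub_def)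
    have 3: "(\<lambda>x. affine_coord n 1 (?U x) y) \<in> borel \<rightarrow>\<^sub>M borel"
      by (rule measurable_into_seq) (simp add: affine_coord_def lin_def)
    have "(\<integral>\<^sup>+x. ?iA (?U x) * ?iB (affine_coord n 1 (?U x) y) \<partial>leb n)
       = (\<integral>\<^sup>+x. ?iA (?U (affine_coord n 1 (\<lambda>i. - z i) x))
           * ?iB (affine_coord n 1 (?U (affine_coord n 1 (\<lambda>i. - z i) x)) y) \<partial>leb n)"
      using 3 by (intro leb_affine_nn[symmetric]) (auto, measurable)
    then show "(\<integral>\<^sup>+x. ?iA (?U x) * ?iB (affine_coord n 1 (?U x) y) \<partial>leb n)
       = (\<integral>\<^sup>+x. ?iA (affine_coord n (-1) (?U x) y) * ?iB (?U x) \<partial>leb n)"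
      by (simp only: 2) (simp only: 1)
  qed
  also have "\<dots> = (\<integral>\<^sup>+x. \<integral>\<^sup>+y. ?iA (affine_coord n (-1) (?U x) y) * ?iB (?U x) \<partial>leb n \<partial>leb n)"
    by (rule P.Fubini') measurable
  also have "\<dots> = (\<integral>\<^sup>+x. emeasure (leb n) A * ?iB (?U x) \<partial>leb n)"
  proof (rule nn_integral_cong)
    fix x
    have "(\<integral>\<^sup>+y. ?iA (affine_coord n (-1) (?U x) y) * ?iB (?U x) \<partial>leb n)
       = (\<integral>\<^sup>+y. ?iA (affine_coord n (-1) (?U x) y) \<partial>leb n) * ?iB (?U x)"
      by (rule nn_integral_multc) measurable
    also have "(\<integral>\<^sup>+y. ?iA (affine_coord n (-1) (?U x) y) \<partial>leb n) = (\<integral>\<^sup>+y. ?iA y \<partial>leb n)"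
      by (rule leb_affine_nn) auto
    finally show "(\<integral>\<^sup>+y. ?iA (affine_coord n (-1) (?U x) y) * ?iB (?U x) \<partial>leb n)
       = emeasure (leb n) A * ?iB (?U x)" by simp
  qed
  also have "\<dots> = emeasure (leb n) A * emeasure (leb n) (?U -` B)"
    unfolding eB by (rule nn_integral_cmult) measurable
  finally show ?thesis .
qed

lemma leb_orthogonal:
  assumes n: "n \<ge> 1" and a: "orthogonal_map n a" and A: "A \<in> sets borel"
  shows "emeasure (leb n) (lin n a -` A) = emeasure (leb n) A"
proof -
  have "lin n a -` shell n = shell n" by (auto simp: shell_def orthogonal_L2[OF a])
  then have "emeasure (leb n) (lin n a -` A) * emeasure (leb n) (shell n)
      = emeasure (leb n) A * emeasure (leb n) (shell n)"
    using leb_lin_aux[of n a A "shell n"] a A by (simp add: orthogonal_map_def)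
  then show ?thesis
    using shell_pos[OF n] shell_finite[of n]
    by (metis ennreal_mult_cancel_left infinity_ennreal_def less_irrefl mult.commute)
qed

lemma radial_sphere: "n \<ge> 1 \<Longrightarrow> radial n x \<in> unit_sphere n"
proof -
  assume n: "n \<ge> 1"
  have "L2_set (radial n x) {1..n} = 1"
  proof (cases "L2_set x {1..n} = 0")
    case True
    then have "L2_set (radial n x) {1..n} = sqrt (\<Sum>i=1..n. if i = 1 then 1 else 0)"
      unfolding L2_set_def radial_def
      by (intro arg_cong[where f = sqrt] sum.cong) auto
    then show ?thesis using n by simp
  next
    case False
    have "L2_set (radial n x) {1..n} = L2_set (\<lambda>i. (1 / L2_set x {1..n}) * x i) {1..n}"
      using False by (intro L2_set_cong) (auto simp: radial_def)
    also have "\<dots> = 1 / L2_set x {1..n} * L2_set x {1..n}"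
      by (rule L2_set_right_distrib[symmetric]) (simp add: L2_set_nonneg)
    finally show ?thesis using False by simp
  qed
  then show ?thesis by (auto simp: unit_sphere_def Rsub_def radial_def)
qed

lemma ex_rotation_invariant_prob:
  assumes n: "n \<ge> 1"
  shows "\<exists>\<mu>. rotation_invariant_prob n \<mu>"
proof -
  define Q where "Q = uniform_measure (leb n) (shell n)"
  define R where "R = restrict_space borel (unit_sphere n)"
  define \<mu> where "\<mu> = distr Q R (radial n)"
  have sQ [measurable_cong]: "sets Q = sets borel" and spQ: "space Q = UNIV" by (auto simp: Q_def)
  have rad: "radial n \<in> Q \<rightarrow>\<^sub>M R"
    unfolding R_def
    by (rule measurable_restrict_space2) (use radial_sphere[OF n] in \<open>auto, measurable\<close>)
  have pQ: "prob_space Q"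
    unfolding Q_def using shell_pos[OF n] shell_finite[of n]
    by (intro prob_space_uniform_measure) auto
  have p\<mu>: "prob_space \<mu>"
    unfolding \<mu>_def by (rule prob_space.prob_space_distr[OF pQ rad])
  have s\<mu>: "sets \<mu> = sets R" and sp\<mu>: "space \<mu> = space R" by (auto simp: \<mu>_def)
  have spR: "space R = unit_sphere n" by (simp add: R_def space_restrict_space)
  have "distr \<mu> \<mu> (lin n a) = \<mu>" if a: "orthogonal_map n a" for a
  proof -
    let ?U = "lin n a"
    have US: "?U x \<in> unit_sphere n" if "x \<in> unit_sphere n" for x
      using that orthogonal_L2[OF a] lin_Rn by (auto simp: unit_sphere_def)
    have URR: "?U \<in> R \<rightarrow>\<^sub>M R"
      unfolding R_def
      by (rule measurable_restrict_space2)
        (use US in \<open>auto simp: space_restrict_space intro!: measurable_restrict_space1\<close>)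
    have comm: "radial n (?U x) = ?U (radial n x)" if "x \<in> shell n" for x
    proof -
      have nz: "L2_set x {1..n} \<noteq> 0" using that by (auto simp: shell_def)
      show ?thesis
      proof (rule ext)
        fix i
        have "radial n (?U x) i = (if i \<in> {1..n} then ?U x i / L2_set x {1..n} else 0)"
          using nz by (simp add: radial_def orthogonal_L2[OF a])
        also have "\<dots> = (if i \<in> {1..n} then \<Sum>j=1..n. a i j * (x j / L2_set x {1..n}) else 0)"
          by (simp add: lin_def sum_divide_distrib)
        also have "\<dots> = ?U (radial n x) i"
          using nz by (simp add: lin_def radial_def)
        finally show "radial n (?U x) i = ?U (radial n x) i" .
      qed
    qed
    have "distr \<mu> \<mu> ?U = distr \<mu> R ?U"
      by (rule distr_cong) (auto simp: s\<mu>)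
    also have "\<dots> = distr Q R (?U \<circ> radial n)"
      unfolding \<mu>_def using URR rad by (rule distr_distr)
    also have "\<dots> = distr Q R (radial n)"
    proof (rule measure_eqI)
      fix A assume "A \<in> sets (distr Q R (?U \<circ> radial n))"
      then have AR: "A \<in> sets R" by simp
      then have A: "A \<in> sets borel"
        unfolding R_def by (auto simp: sets_restrict_space)
      have m: "radial n -` A \<in> sets borel"
        using measurable_sets[OF measurable_radial A] by simp
      have m': "(?U \<circ> radial n) -` A \<in> sets borel"
        using measurable_sets[OF measurable_comp[OF measurable_radial measurable_lin] A] by simp
      have "?U x \<in> shell n \<longleftrightarrow> x \<in> shell n" for x
        by (simp add: shell_def orthogonal_L2[OF a])
      then have eq: "shell n \<inter> (?U \<circ> radial n) -` A = ?U -` (shell n \<inter> radial n -` A)"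
        using comm by auto
      have "emeasure (distr Q R (?U \<circ> radial n)) A = emeasure Q ((?U \<circ> radial n) -` A)"
        using emeasure_distr[OF measurable_comp[OF rad URR] AR] by (simp add: spQ)
      also have "\<dots> = emeasure (leb n) (shell n \<inter> (?U \<circ> radial n) -` A) / emeasure (leb n) (shell n)"
        unfolding Q_def using m' by (intro emeasure_uniform_measure) auto
      also have "\<dots> = emeasure (leb n) (shell n \<inter> radial n -` A) / emeasure (leb n) (shell n)"
        unfolding eq using m by (subst leb_orthogonal[OF n a]) auto
      also have "\<dots> = emeasure Q (radial n -` A)"
        unfolding Q_def using m by (intro emeasure_uniform_measure[symmetric]) auto
      also have "\<dots> = emeasure (distr Q R (radial n)) A"
        using emeasure_distr[OF rad AR] by (simp add: spQ)
      finally show "emeasure (distr Q R (?U \<circ> radial n)) A = emeasure (distr Q R (radial n)) A" .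
    qed simp
    finally show ?thesis by (simp add: \<mu>_def)
  qed
  then show ?thesis
    using p\<mu> s\<mu> unfolding rotation_invariant_prob_def R_def by blast
qed

lemma rotation_invariant_prob_sphere_measure:
  "n \<ge> 1 \<Longrightarrow> rotation_invariant_prob n (sphere_measure n)"
  unfolding sphere_measure_def by (rule someI_ex) (rule ex_rotation_invariant_prob)

end

end

theory Submission
  imports Defs
begin

text \<open>
  Let \<open>E = A D\<^sub>n\<close>, \<open>T = A\<^sup>-\<^sup>1\<close> and \<open>H = T\<^sup>T T\<close>. Invariance of the sphere measure gives
  \<open>tr H = n M\<^sub>E\<^sup>2\<close>, and the projection of \<open>E\<close> onto \<open>R\<^sup>\<sigma>\<close> contains the ball of radius \<open>t\<close> as soon
  as the Schur complement of \<open>H\<close> on \<open>\<sigma>\<close> has norm at most \<open>1 / t\<^sup>2\<close>.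

  The complement \<open>\<tau>\<close> of \<open>\<sigma>\<close> is chosen greedily, one Gaussian pivot at a time, with a barrier
  argument in the style of Batson, Spielman and Srivastava. With \<open>S = tr H\<close>, after \<open>s\<close> pivots the
  residual matrix \<open>K\<close> satisfies \<open>K < b\<close> and \<open>tr K (b - K)\<^sup>-\<^sup>1 \<le> 1 + s / 2\<close> for \<open>b = 4 S / (s + 2)\<close>.
  Lowering the barrier raises the potential, but the average over \<open>i\<close> (with suitable weights) of the
  decrease caused by a pivot at \<open>i\<close> compensates for all but \<open>1 / 2\<close> of it. After at least \<open>\<theta> n\<close>
  pivots \<open>K \<le> 4 M\<^sub>E\<^sup>2 / \<theta>\<close>, so the projection contains the ball of radius \<open>\<surd>\<theta> / (2 M\<^sub>E)\<close>, without a
  logarithmic loss; its integer points are the ones counted by \<open>d\<close>.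
\<close>

subsection \<open>The spectral theorem for symmetric matrices\<close>

text \<open>The rows \<open>w k\<close> are the basis vectors. Orthonormality of the rows lets
  eigenvectors be read off; orthonormality of the columns is the completeness relation behind
  \<open>parseval\<close>.\<close>

definition orthogonal_on :: "'a set \<Rightarrow> ('a \<Rightarrow> 'a \<Rightarrow> real) \<Rightarrow> bool" where
  "orthogonal_on I w \<longleftrightarrow>
    (\<forall>k\<in>I. \<forall>l\<in>I. (\<Sum>i\<in>I. w k i * w l i) = of_bool (k = l)) \<and>
    (\<forall>i\<in>I. \<forall>j\<in>I. (\<Sum>l\<in>I. w l i * w l j) = of_bool (i = j))"

definition bform :: "'a set \<Rightarrow> ('a \<Rightarrow> 'a \<Rightarrow> real) \<Rightarrow> ('a \<Rightarrow> real) \<Rightarrow> ('a \<Rightarrow> real) \<Rightarrow> real" where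
  "bform I K x y = (\<Sum>i\<in>I. \<Sum>j\<in>I. K i j * x i * y j)"

lemma bform_add_left: "bform I K (\<lambda>i. a * x i + b * y i) z = a * bform I K x z + b * bform I K y z"
  by (simp add: bform_def sum_distrib_left algebra_simps flip: sum.distrib)

lemma bform_add_right: "bform I K z (\<lambda>i. a * x i + b * y i) = a * bform I K z x + b * bform I K z y"
  by (simp add: bform_def sum_distrib_left algebra_simps flip: sum.distrib)

lemma bform_commute:
  assumes "\<And>i j. i \<in> I \<Longrightarrow> j \<in> I \<Longrightarrow> K i j = K j i"
  shows "bform I K x y = bform I K y x"
  unfolding bform_def
  by (subst sum.swap) (intro sum.cong refl, simp add: assms mult.commute mult.left_commute)

lemma sum_of_bool_mult:
  fixes f :: "'a \<Rightarrow> real"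
  assumes "finite I" "i \<in> I"
  shows "(\<Sum>j\<in>I. of_bool (j = i) * f j) = f i" "(\<Sum>j\<in>I. of_bool (i = j) * f j) = f i"
proof -
  have "(\<Sum>j\<in>I. of_bool (j = i) * f j) = (\<Sum>j\<in>I. if j = i then f j else 0)"
    by (intro sum.cong) auto
  then show 1: "(\<Sum>j\<in>I. of_bool (j = i) * f j) = f i" using assms by simp
  show "(\<Sum>j\<in>I. of_bool (i = j) * f j) = f i" using 1 by (simp add: eq_commute[of i])
qed

lemma sum_remove2:
  fixes g :: "'a \<Rightarrow> real"
  assumes "finite I" "p \<in> I" "q \<in> I" "p \<noteq> q"
  shows "sum g I = g p + g q + sum g (I - {p, q})"
proof -
  have "I - {p, q} = I - {p} - {q}" by auto
  then show ?thesis
    using assms by (simp add: sum.remove[of I p] sum.remove[of "I - {p}" q])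
qed

section \<open>Jacobi rotations and compactness of the orthogonal group\<close>

text \<open>For a symmetric 2 by 2 block with diagonal a, d and off-diagonal entry \<open>B\<close>,
  and with \<open>D\<close> = d - a, the expression is the off-diagonal entry after rotation.
  Dividing by c^2 leaves B t^2 - D t - B = 0 for t = s / c, whose discriminant D^2 + 4 B^2 is
  nonnegative.\<close>

lemma rotation_killing_off_diagonal:
  fixes B D :: real
  shows "\<exists>c s. c\<^sup>2 + s\<^sup>2 = 1 \<and> (c\<^sup>2 - s\<^sup>2) * B + c * s * D = 0"
proof (cases "B = 0")
  case True
  then show ?thesis by (intro exI[of _ 1] exI[of _ 0]) simp
next
  case False
  define t where "t = (D + sqrt (D\<^sup>2 + 4 * B\<^sup>2)) / (2 * B)"
  have "(sqrt (D\<^sup>2 + 4 * B\<^sup>2))\<^sup>2 = D\<^sup>2 + 4 * B\<^sup>2" by simp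
  moreover have "2 * B * t - D = sqrt (D\<^sup>2 + 4 * B\<^sup>2)" using False by (simp add: t_def)
  ultimately have "(2 * B * t - D)\<^sup>2 = D\<^sup>2 + 4 * B\<^sup>2" by simp
  then have "4 * B * (B * (1 - t\<^sup>2) + t * D) = 0" by (simp add: power2_eq_square algebra_simps)
  then have t: "B * (1 - t\<^sup>2) + t * D = 0" using False by simp
  define c where "c = 1 / sqrt (1 + t\<^sup>2)"
  have pos: "1 + t\<^sup>2 > 0" by (simp add: add_pos_nonneg)
  then have c: "c\<^sup>2 = 1 / (1 + t\<^sup>2)" by (simp add: c_def power_divide)
  have "c\<^sup>2 + (t * c)\<^sup>2 = c\<^sup>2 * (1 + t\<^sup>2)" by (simp add: power_mult_distrib algebra_simps)
  also have "\<dots> = 1" using pos by (simp add: c)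
  finally have 1: "c\<^sup>2 + (t * c)\<^sup>2 = 1" .
  have "(c\<^sup>2 - (t * c)\<^sup>2) * B + c * (t * c) * D = c\<^sup>2 * (B * (1 - t\<^sup>2) + t * D)"
    by (simp add: power2_eq_square algebra_simps)
  then show ?thesis using 1 t by (intro exI[of _ c] exI[of _ "t * c"]) simp
qed

text \<open>Only the rows \<open>p\<close> and \<open>q\<close> change. The row products follow by
  bilinearity, the column products because the rotation preserves
  \<open>w p i * w p j + w q i * w q j\<close>.\<close>

lemma orthogonal_on_rotate:
  assumes I: "finite I" "p \<in> I" "q \<in> I" "p \<noteq> q" and w: "orthogonal_on I w" and cs: "c\<^sup>2 + s\<^sup>2 = 1"
  shows "orthogonal_on I (w(p := \<lambda>i. c * w p i + s * w q i, q := \<lambda>i. (-s) * w p i + c * w q i))"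
    (is "orthogonal_on I ?w")
proof -
  define ip :: "('a \<Rightarrow> real) \<Rightarrow> ('a \<Rightarrow> real) \<Rightarrow> real" where "ip x y = (\<Sum>i\<in>I. x i * y i)" for x y
  have ip1: "ip (\<lambda>i. a * x i + b * y i) z = a * ip x z + b * ip y z" for a b x y z
    by (simp add: ip_def sum_distrib_left algebra_simps flip: sum.distrib)
  have ip2: "ip z (\<lambda>i. a * x i + b * y i) = a * ip z x + b * ip z y" for a b x y z
    by (simp add: ip_def sum_distrib_left algebra_simps flip: sum.distrib)
  have ip3: "ip (\<lambda>i. a * x i - b * y i) z = a * ip x z - b * ip y z" for a b x y z
    using ip1[of a x "-b"] by simp
  have ip4: "ip z (\<lambda>i. a * x i - b * y i) = a * ip z x - b * ip z y" for a b x y z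
    using ip2[of z a x "-b"] by simp
  have o: "ip (w k) (w l) = of_bool (k = l)" if "k \<in> I" "l \<in> I" for k l
    using w that by (simp add: orthogonal_on_def ip_def)
  have cs': "c * c + s * s = 1" using cs by (simp add: power2_eq_square)
  have "ip (?w k) (?w l) = of_bool (k = l)" if "k \<in> I" "l \<in> I" for k l
    using that I o cs' by (auto simp: ip1 ip2 ip3 ip4)
  moreover have "(\<Sum>l\<in>I. ?w l i * ?w l j) = of_bool (i = j)" if "i \<in> I" "j \<in> I" for i j
  proof -
    have "(\<Sum>l\<in>I. ?w l i * ?w l j) = ?w p i * ?w p j + ?w q i * ?w q j
        + (\<Sum>l\<in>I - {p, q}. ?w l i * ?w l j)"
      by (rule sum_remove2[OF I])
    also have "(\<Sum>l\<in>I - {p, q}. ?w l i * ?w l j) = (\<Sum>l\<in>I - {p, q}. w l i * w l j)"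
      by (intro sum.cong) auto
    also have "?w p i * ?w p j + ?w q i * ?w q j = (c\<^sup>2 + s\<^sup>2) * (w p i * w p j + w q i * w q j)"
      using I by (simp add: power2_eq_square algebra_simps)
    also have "\<dots> + (\<Sum>l\<in>I - {p, q}. w l i * w l j) = (\<Sum>l\<in>I. w l i * w l j)"
      using cs by (simp add: sum_remove2[OF I, of "\<lambda>l. w l i * w l j"])
    also have "\<dots> = of_bool (i = j)" using w that by (simp add: orthogonal_on_def)
    finally show ?thesis .
  qed
  ultimately show ?thesis unfolding orthogonal_on_def ip_def by blast
qed

lemma orthogonal_on_abs_le_1:
  assumes "finite I" "orthogonal_on I w" "k \<in> I" "i \<in> I"
  shows "\<bar>w k i\<bar> \<le> 1"
proof -
  have "(w k i)\<^sup>2 \<le> (\<Sum>i\<in>I. (w k i)\<^sup>2)" using assms by (intro member_le_sum) auto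
  also have "\<dots> = 1" using assms by (simp add: orthogonal_on_def power2_eq_square)
  finally show ?thesis by (simp add: abs_square_le_1)
qed

text \<open>Orthogonality is a closed condition that bounds all entries on \<open>I\<close> by 1, so
  this is a closed part of a product of compact intervals. Since \<open>w\<close> is a total
  function, its entries off \<open>I\<close> are pinned to 0; left free, they would destroy
  compactness.\<close>

lemma compact_orthogonal_on:
  assumes "finite I"
  shows "compact {w. orthogonal_on I w \<and> (\<forall>k i. k \<notin> I \<or> i \<notin> I \<longrightarrow> w k i = 0)}"
proof -
  define J :: "'a \<Rightarrow> 'a \<Rightarrow> real set" where
    "J k i = (if k \<in> I \<and> i \<in> I then {-1..1} else {0})" for k i
  have row: "compact (PiE UNIV (J k))" for k
    using compactin_PiE[of "\<lambda>_. euclidean" UNIV "J k"]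
    by (simp add: euclidean_product_topology compactin_euclidean_iff J_def)
  have box: "compact (PiE UNIV (\<lambda>k. PiE UNIV (J k)))"
    using compactin_PiE[of "\<lambda>_. euclidean" UNIV "\<lambda>k. PiE UNIV (J k)"] row
    by (simp add: euclidean_product_topology compactin_euclidean_iff)
  have ent: "continuous_on UNIV (\<lambda>w :: 'a \<Rightarrow> 'a \<Rightarrow> real. w k i)" for k i
    by (rule continuous_on_product_then_coordinatewise[OF continuous_on_product_coordinates])
  have "closed {w :: 'a \<Rightarrow> 'a \<Rightarrow> real. orthogonal_on I w}"
    unfolding orthogonal_on_def Ball_def
    by (intro closed_Collect_conj closed_Collect_all closed_Collect_imp closed_Collect_eq
      open_Collect_const continuous_intros ent)
  then have "compact (PiE UNIV (\<lambda>k. PiE UNIV (J k)) \<inter> {w. orthogonal_on I w})"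
    by (rule compact_Int_closed[OF box])
  also have "PiE UNIV (\<lambda>k. PiE UNIV (J k)) \<inter> {w. orthogonal_on I w}
    = {w. orthogonal_on I w \<and> (\<forall>k i. k \<notin> I \<or> i \<notin> I \<longrightarrow> w k i = 0)}"
    using orthogonal_on_abs_le_1[OF assms]
    by (auto simp: J_def PiE_UNIV_domain Pi_iff abs_le_iff minus_le_iff split: if_splits) blast+
  finally show ?thesis .
qed

text \<open>Change of basis: once the form is expanded, completeness of \<open>w\<close> collapses
  the sums over \<open>l\<close> and \<open>m\<close> to \<open>a = i\<close> and
  \<open>b = j\<close>.\<close>

lemma bform_diagonalized:
  assumes "finite I" "orthogonal_on I w" "i \<in> I" "j \<in> I"
  shows "K i j = (\<Sum>l\<in>I. \<Sum>m\<in>I. bform I K (w l) (w m) * w l i * w m j)"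
proof -
  have "(\<Sum>l\<in>I. \<Sum>m\<in>I. bform I K (w l) (w m) * w l i * w m j)
      = (\<Sum>l\<in>I. \<Sum>m\<in>I. \<Sum>a\<in>I. \<Sum>b\<in>I. K a b * (w l a * w l i) * (w m b * w m j))"
    by (simp add: bform_def sum_distrib_right sum_distrib_left mult_ac)
  also have "\<dots> = (\<Sum>a\<in>I. \<Sum>b\<in>I. \<Sum>l\<in>I. \<Sum>m\<in>I. K a b * (w l a * w l i) * (w m b * w m j))"
  proof -
    let ?g = "\<lambda>l m a b. K a b * (w l a * w l i) * (w m b * w m j)"
    have "(\<Sum>l\<in>I. \<Sum>m\<in>I. \<Sum>a\<in>I. \<Sum>b\<in>I. ?g l m a b) = (\<Sum>l\<in>I. \<Sum>a\<in>I. \<Sum>m\<in>I. \<Sum>b\<in>I. ?g l m a b)"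
      by (intro sum.cong refl sum.swap)
    also have "\<dots> = (\<Sum>a\<in>I. \<Sum>l\<in>I. \<Sum>m\<in>I. \<Sum>b\<in>I. ?g l m a b)" by (rule sum.swap)
    also have "\<dots> = (\<Sum>a\<in>I. \<Sum>l\<in>I. \<Sum>b\<in>I. \<Sum>m\<in>I. ?g l m a b)" by (intro sum.cong refl sum.swap)
    also have "\<dots> = (\<Sum>a\<in>I. \<Sum>b\<in>I. \<Sum>l\<in>I. \<Sum>m\<in>I. ?g l m a b)" by (intro sum.cong refl sum.swap)
    finally show ?thesis .
  qed
  also have "\<dots> = (\<Sum>a\<in>I. \<Sum>b\<in>I. K a b * (\<Sum>l\<in>I. w l a * w l i) * (\<Sum>m\<in>I. w m b * w m j))"
    by (simp add: sum_distrib_left sum_distrib_right mult_ac)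
  also have "\<dots> = (\<Sum>a\<in>I. \<Sum>b\<in>I. K a b * of_bool (a = i) * of_bool (b = j))"
    using assms by (intro sum.cong refl) (simp add: orthogonal_on_def)
  also have "\<dots> = (\<Sum>a\<in>I. of_bool (a = i) * (\<Sum>b\<in>I. of_bool (b = j) * K a b))"
    unfolding sum_distrib_left by (intro sum.cong refl) (simp add: mult_ac)
  also have "\<dots> = K i j" using assms by (simp add: sum_of_bool_mult)
  finally show ?thesis by simp
qed

text \<open>An orthogonal matrix that maximizes the sum of the squared diagonal entries diagonalizes \<open>K\<close>,
  since a Jacobi rotation removing an off-diagonal entry \<open>B\<close> would increase that sum by \<open>2 B\<^sup>2\<close>.\<close>

theorem symmetric_diagonalizable:
  assumes I: "finite I" and K: "\<And>i j. i \<in> I \<Longrightarrow> j \<in> I \<Longrightarrow> K i j = K j i"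
  shows "\<exists>lam w. orthogonal_on I w \<and> (\<forall>i\<in>I. \<forall>j\<in>I. K i j = (\<Sum>l\<in>I. lam l * w l i * w l j))"
proof -
  define C where "C = {w :: 'a \<Rightarrow> 'a \<Rightarrow> real.
    orthogonal_on I w \<and> (\<forall>k i. k \<notin> I \<or> i \<notin> I \<longrightarrow> w k i = 0)}"
  define f where "f w = (\<Sum>l\<in>I. (bform I K (w l) (w l))\<^sup>2)" for w :: "'a \<Rightarrow> 'a \<Rightarrow> real"
  have ent: "continuous_on C (\<lambda>w :: 'a \<Rightarrow> 'a \<Rightarrow> real. w k i)" for k i
    by (rule continuous_on_subset[OF
      continuous_on_product_then_coordinatewise[OF continuous_on_product_coordinates]]) simp
  have "(\<lambda>k i. of_bool (k \<in> I \<and> k = i)) \<in> C"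
    using I by (auto simp: C_def orthogonal_on_def sum_of_bool_mult simp flip: of_bool_conj)
  then have "C \<noteq> {}" by blast
  moreover have "continuous_on C f"
    unfolding f_def bform_def by (intro continuous_intros ent)
  ultimately obtain w where w: "w \<in> C" and max: "\<And>w'. w' \<in> C \<Longrightarrow> f w' \<le> f w"
    using continuous_attains_sup[of C f] compact_orthogonal_on[OF I] unfolding C_def by blast
  have ow: "orthogonal_on I w" using w by (simp add: C_def)
  have off: "bform I K (w p) (w q) = 0" if pq: "p \<in> I" "q \<in> I" "p \<noteq> q" for p q
  proof -
    define a d B where "a = bform I K (w p) (w p)" and "d = bform I K (w q) (w q)"
      and "B = bform I K (w p) (w q)"
    have B': "bform I K (w q) (w p) = B" unfolding B_def by (rule bform_commute[OF K])
    obtain c s where cs: "c\<^sup>2 + s\<^sup>2 = 1" and z: "(c\<^sup>2 - s\<^sup>2) * B + c * s * (d - a) = 0"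
      using rotation_killing_off_diagonal by blast
    define w' where "w' = w(p := \<lambda>i. c * w p i + s * w q i, q := \<lambda>i. (-s) * w p i + c * w q i)"
    have w'p: "w' p = (\<lambda>i. c * w p i + s * w q i)" and w'q: "w' q = (\<lambda>i. (-s) * w p i + c * w q i)"
      using pq by (auto simp: w'_def)
    have "w' \<in> C"
      using orthogonal_on_rotate[OF I pq ow cs] w pq by (auto simp: C_def w'_def)
    define g where "g = (\<lambda>l. (bform I K (w l) (w l))\<^sup>2)"
    define g' where "g' = (\<lambda>l. (bform I K (w' l) (w' l))\<^sup>2)"
    have rest: "sum g' (I - {p, q}) = sum g (I - {p, q})"
      by (intro sum.cong) (auto simp: g_def g'_def w'_def)
    have "sum g' I \<le> sum g I" using max[OF \<open>w' \<in> C\<close>] by (simp add: f_def g_def g'_def)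
    then have le: "g' p + g' q \<le> g p + g q"
      using sum_remove2[OF I pq, of g] sum_remove2[OF I pq, of g'] rest by simp
    have a': "bform I K (w' p) (w' p) = c\<^sup>2 * a + 2 * c * s * B + s\<^sup>2 * d"
      unfolding w'p bform_add_left bform_add_right B'
      by (simp add: a_def[symmetric] d_def[symmetric] B_def[symmetric] power2_eq_square algebra_simps)
    have d': "bform I K (w' q) (w' q) = c\<^sup>2 * d - 2 * c * s * B + s\<^sup>2 * a"
      unfolding w'q bform_add_left bform_add_right B'
      by (simp add: a_def[symmetric] d_def[symmetric] B_def[symmetric] power2_eq_square algebra_simps)
    \<comment> \<open>The rotation preserves the sum of squares of all four entries of the block;
      the bracket on the left is the new off-diagonal entry, which \<open>z\<close> makes
      zero.\<close>
    have "g' p + g' q + 2 * ((c\<^sup>2 - s\<^sup>2) * B + c * s * (d - a))\<^sup>2 = (c\<^sup>2 + s\<^sup>2)\<^sup>2 * (a\<^sup>2 + d\<^sup>2 + 2 * B\<^sup>2)"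
      unfolding g'_def a' d' by algebra
    then have "g' p + g' q = a\<^sup>2 + d\<^sup>2 + 2 * B\<^sup>2" using cs z by simp
    with le have "B\<^sup>2 \<le> 0" by (simp add: g_def a_def d_def)
    then show ?thesis by (simp add: B_def)
  qed
  have "K i j = (\<Sum>l\<in>I. bform I K (w l) (w l) * w l i * w l j)" if ij: "i \<in> I" "j \<in> I" for i j
  proof -
    have "(\<Sum>m\<in>I. bform I K (w l) (w m) * w l i * w m j) = bform I K (w l) (w l) * w l i * w l j"
      if "l \<in> I" for l
    proof -
      have "(\<Sum>m\<in>I - {l}. bform I K (w l) (w m) * w l i * w m j) = 0"
        using off[OF that] by (intro sum.neutral) auto
      then show ?thesis using that I by (simp add: sum.remove[of I l])
    qed
    then show ?thesis using bform_diagonalized[OF I ow ij, of K] by simp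
  qed
  then show ?thesis using ow by (intro exI[of _ "\<lambda>l. bform I K (w l) (w l)"] exI[of _ w]) blast
qed

section \<open>Quadratic forms in an eigenbasis\<close>

lemma parseval:
  assumes I: "finite I" and w: "orthogonal_on I w"
  shows "(\<Sum>l\<in>I. (\<Sum>i\<in>I. x i * w l i) * (\<Sum>i\<in>I. y i * w l i)) = (\<Sum>i\<in>I. x i * y i)"
proof -
  have "(\<Sum>l\<in>I. (\<Sum>i\<in>I. x i * w l i) * (\<Sum>i\<in>I. y i * w l i))
    = (\<Sum>l\<in>I. \<Sum>i\<in>I. \<Sum>j\<in>I. x i * y j * (w l i * w l j))"
    by (simp add: sum_product mult_ac)
  also have "\<dots> = (\<Sum>i\<in>I. \<Sum>l\<in>I. \<Sum>j\<in>I. x i * y j * (w l i * w l j))" by (rule sum.swap)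
  also have "\<dots> = (\<Sum>i\<in>I. \<Sum>j\<in>I. \<Sum>l\<in>I. x i * y j * (w l i * w l j))"
    by (intro sum.cong refl sum.swap)
  also have "\<dots> = (\<Sum>i\<in>I. \<Sum>j\<in>I. of_bool (i = j) * (x i * y j))"
    using w by (intro sum.cong refl) (simp add: orthogonal_on_def flip: sum_distrib_left)
  also have "\<dots> = (\<Sum>i\<in>I. x i * y i)" using I by (simp add: sum_of_bool_mult)
  finally show ?thesis .
qed

definition eigen_decomp ::
    "'a set \<Rightarrow> ('a \<Rightarrow> 'a \<Rightarrow> real) \<Rightarrow> ('a \<Rightarrow> real) \<Rightarrow> ('a \<Rightarrow> 'a \<Rightarrow> real) \<Rightarrow> bool" where
  "eigen_decomp I K lam w \<longleftrightarrow> orthogonal_on I w \<and>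
    (\<forall>i\<in>I. \<forall>j\<in>I. K i j = (\<Sum>l\<in>I. lam l * w l i * w l j))"

lemma bform_eigen_decomp:
  assumes "eigen_decomp I K lam w"
  shows "bform I K x y = (\<Sum>l\<in>I. lam l * (\<Sum>i\<in>I. x i * w l i) * (\<Sum>i\<in>I. y i * w l i))"
proof -
  have "bform I K x y = (\<Sum>i\<in>I. \<Sum>j\<in>I. \<Sum>l\<in>I. lam l * (x i * w l i) * (y j * w l j))"
    unfolding bform_def using assms
    by (intro sum.cong refl) (simp add: eigen_decomp_def sum_distrib_left sum_distrib_right mult_ac)
  also have "\<dots> = (\<Sum>i\<in>I. \<Sum>l\<in>I. \<Sum>j\<in>I. lam l * (x i * w l i) * (y j * w l j))"
    by (intro sum.cong refl sum.swap)
  also have "\<dots> = (\<Sum>l\<in>I. \<Sum>i\<in>I. \<Sum>j\<in>I. lam l * (x i * w l i) * (y j * w l j))"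
    by (rule sum.swap)
  also have "\<dots> = (\<Sum>l\<in>I. lam l * (\<Sum>i\<in>I. x i * w l i) * (\<Sum>i\<in>I. y i * w l i))"
    by (simp add: sum_distrib_left sum_distrib_right mult_ac)
  finally show ?thesis .
qed

lemma bform_eigenvector_left:
  assumes I: "finite I" and K: "eigen_decomp I K lam w" and m: "m \<in> I"
  shows "bform I K (w m) y = lam m * (\<Sum>i\<in>I. y i * w m i)"
proof -
  have "bform I K (w m) y = (\<Sum>l\<in>I. of_bool (m = l) * (lam l * (\<Sum>i\<in>I. y i * w l i)))"
    unfolding bform_eigen_decomp[OF K]
    using K m by (intro sum.cong refl) (simp add: eigen_decomp_def orthogonal_on_def)
  then show ?thesis using I m by (simp add: sum_of_bool_mult)
qed

lemma eigen_decomp_commute: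
  "eigen_decomp I K lam w \<Longrightarrow> i \<in> I \<Longrightarrow> j \<in> I \<Longrightarrow> K i j = K j i"
  by (simp add: eigen_decomp_def mult_ac)

lemma eigen_decomp_row:
  assumes I: "finite I" and K: "eigen_decomp I K lam w" and m: "m \<in> I" and i: "i \<in> I"
  shows "(\<Sum>a\<in>I. K a i * w m a) = lam m * w m i"
proof -
  have "bform I K (w m) (\<lambda>j. of_bool (j = i)) = (\<Sum>a\<in>I. \<Sum>j\<in>I. of_bool (j = i) * (K a j * w m a))"
    by (simp add: bform_def mult_ac)
  then have "bform I K (w m) (\<lambda>j. of_bool (j = i)) = (\<Sum>a\<in>I. K a i * w m a)"
    using I i by (simp add: sum_of_bool_mult)
  then show ?thesis
    using bform_eigenvector_left[OF I K m, of "\<lambda>j. of_bool (j = i)"] I i by (simp add: sum_of_bool_mult)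
qed

subsection \<open>The barrier argument\<close>

text \<open>The Sherman--Morrison formula for the trace of \<open>(b - K + v v\<^sup>T)\<^sup>-\<^sup>1\<close>, read off in the
  two eigenbases.\<close>

lemma trace_resolvent_rank_one_downdate:
  assumes I: "finite I" and K: "eigen_decomp I K lam w" and K': "eigen_decomp I K' lam' w'"
    and upd: "\<And>i j. i \<in> I \<Longrightarrow> j \<in> I \<Longrightarrow> K' i j = K i j - v i * v j"
    and b: "\<And>l. l \<in> I \<Longrightarrow> lam l < b"
  defines "vh \<equiv> \<lambda>l. \<Sum>i\<in>I. v i * w l i"
  shows "\<And>j. j \<in> I \<Longrightarrow> lam' j < b"
    and "(\<Sum>j\<in>I. 1 / (b - lam' j)) = (\<Sum>l\<in>I. 1 / (b - lam l))
      - (\<Sum>l\<in>I. (vh l)\<^sup>2 / (b - lam l)\<^sup>2) / (1 + (\<Sum>l\<in>I. (vh l)\<^sup>2 / (b - lam l)))"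
proof -
  have w: "orthogonal_on I w" and w': "orthogonal_on I w'"
    using K K' by (auto simp: eigen_decomp_def)
  \<comment> \<open>\<open>g\<close> is the change of basis matrix between the eigenvectors of
    \<open>K'\<close> and those of \<open>K\<close>.\<close>
  define g where "g j l = (\<Sum>i\<in>I. w' j i * w l i)" for j l
  define v' where "v' j = (\<Sum>i\<in>I. v i * w' j i)" for j
  have g_row: "(\<Sum>l\<in>I. (g j l)\<^sup>2) = 1" if "j \<in> I" for j
    using parseval[OF I w, of "w' j" "w' j"] w' that
    by (simp add: g_def orthogonal_on_def power2_eq_square)
  have g_col: "(\<Sum>j\<in>I. g j l * g j m) = of_bool (l = m)" if "l \<in> I" "m \<in> I" for l m
    using parseval[OF I w', of "w l" "w m"] w that
    by (simp add: g_def orthogonal_on_def mult.commute)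
  have gv: "(\<Sum>l\<in>I. g j l * vh l) = v' j" if "j \<in> I" for j
    using parseval[OF I w, of "w' j" v] by (simp add: g_def vh_def v'_def mult.commute)
  \<comment> \<open>The entry of b - K' = (b - K) + v v^T between \<open>w' j\<close> and
    \<open>w l\<close>, with each matrix acting on its own eigenvector.\<close>
  have rel: "(b - lam' j) * g j l = (b - lam l) * g j l + v' j * vh l" if "j \<in> I" "l \<in> I" for j l
  proof -
    have "bform I K' (w' j) (w l) = (\<Sum>i\<in>I. \<Sum>k\<in>I. K i k * w' j i * w l k - (v i * w' j i) * (v k * w l k))"
      unfolding bform_def by (intro sum.cong refl) (simp add: upd algebra_simps)
    also have "\<dots> = bform I K (w' j) (w l) - v' j * vh l"
      by (simp add: bform_def v'_def vh_def sum_product sum_subtractf)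
    also have "bform I K (w' j) (w l) = bform I K (w l) (w' j)"
      by (rule bform_commute) (rule eigen_decomp_commute[OF K])
    also have "\<dots> = lam l * g j l"
      using bform_eigenvector_left[OF I K that(2)] by (simp add: g_def)
    also have "bform I K' (w' j) (w l) = lam' j * g j l"
      using bform_eigenvector_left[OF I K' that(1)] by (simp add: g_def mult.commute)
    finally show ?thesis by (simp add: algebra_simps)
  qed
  have pos: "0 < b - lam' j" if j: "j \<in> I" for j
  proof -
    \<comment> \<open>Multiplying \<open>rel\<close> by \<open>g j l\<close> and summing over
      \<open>l\<close> exhibits \<open>b - lam' j\<close> as the value at \<open>w' j\<close> of the
      positive form of b - K + v v^T.\<close>
    have "b - lam' j = (\<Sum>l\<in>I. (b - lam' j) * (g j l)\<^sup>2)"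
      using g_row[OF j] by (simp flip: sum_distrib_left)
    also have "\<dots> = (\<Sum>l\<in>I. (b - lam l) * (g j l)\<^sup>2 + v' j * (g j l * vh l))"
    proof (intro sum.cong refl)
      fix l assume "l \<in> I"
      have "(b - lam' j) * (g j l)\<^sup>2 = ((b - lam' j) * g j l) * g j l" by (simp add: power2_eq_square)
      also have "\<dots> = (b - lam l) * (g j l)\<^sup>2 + v' j * (g j l * vh l)"
        unfolding rel[OF j \<open>l \<in> I\<close>] by (simp add: power2_eq_square algebra_simps)
      finally show "(b - lam' j) * (g j l)\<^sup>2 = (b - lam l) * (g j l)\<^sup>2 + v' j * (g j l * vh l)" .
    qed
    also have "\<dots> = (\<Sum>l\<in>I. (b - lam l) * (g j l)\<^sup>2) + v' j * v' j"
      using gv[OF j] by (simp add: sum.distrib flip: sum_distrib_left)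
    finally have e: "b - lam' j = (\<Sum>l\<in>I. (b - lam l) * (g j l)\<^sup>2) + v' j * v' j" .
    have "0 < (\<Sum>l\<in>I. (b - lam l) * (g j l)\<^sup>2)"
    proof -
      have "\<exists>l\<in>I. g j l \<noteq> 0" using g_row[OF j] by (auto intro: ccontr)
      then obtain l where "l \<in> I" "g j l \<noteq> 0" by blast
      then show ?thesis using b I
        by (intro sum_pos2[of I l]) (auto simp: less_imp_le)
    qed
    then show ?thesis using e by (simp add: add_pos_nonneg)
  qed
  then show "\<And>j. j \<in> I \<Longrightarrow> lam' j < b" by simp
  \<comment> \<open>\<open>c\<close> and, below, \<open>q\<close> are the coordinates of the one
    vector (b - K)^(-1) v in the bases \<open>w\<close> and \<open>w'\<close>. The fact
    \<open>q\<close> then says that b - K' maps this vector to (1 + \<alpha>) v.\<close>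
  define c where "c l = vh l / (b - lam l)" for l
  define \<alpha> where "\<alpha> = (\<Sum>l\<in>I. (vh l)\<^sup>2 / (b - lam l))"
  have "\<alpha> \<ge> 0" unfolding \<alpha>_def using b by (intro sum_nonneg) (simp add: less_imp_le)
  define q where "q j = (\<Sum>l\<in>I. g j l * c l)" for j
  have q: "(b - lam' j) * q j = v' j * (1 + \<alpha>)" if j: "j \<in> I" for j
  proof -
    have "(b - lam' j) * q j = (\<Sum>l\<in>I. ((b - lam' j) * g j l) * c l)"
      by (simp add: q_def sum_distrib_left mult_ac)
    also have "\<dots> = (\<Sum>l\<in>I. g j l * vh l + v' j * ((vh l)\<^sup>2 / (b - lam l)))"
    proof (intro sum.cong refl)
      fix l assume l: "l \<in> I"
      then show "((b - lam' j) * g j l) * c l = g j l * vh l + v' j * ((vh l)\<^sup>2 / (b - lam l))"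
        unfolding rel[OF j l] using b[OF l]
        by (simp add: c_def field_simps power2_eq_square)
    qed
    also have "\<dots> = v' j * (1 + \<alpha>)"
      unfolding sum.distrib gv[OF j] \<alpha>_def sum_distrib_left[symmetric]
      by (simp add: algebra_simps)
    finally show ?thesis .
  qed
  have qq: "(\<Sum>j\<in>I. (q j)\<^sup>2) = (\<Sum>l\<in>I. (c l)\<^sup>2)"
  proof -
    have "orthogonal_on I g"
      using g_col parseval[OF I w] w'
      by (simp add: orthogonal_on_def g_def)
    then show ?thesis
      using parseval[OF I, of g c c] by (simp add: q_def power2_eq_square mult.commute)
  qed
  \<comment> \<open>The trace of (b - K)^(-1) is computed in the basis \<open>w'\<close>, where
    \<open>rel\<close> splits each diagonal entry into that of the new resolvent and a rank-one
    correction.\<close>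
  have "(\<Sum>l\<in>I. 1 / (b - lam l)) = (\<Sum>l\<in>I. \<Sum>j\<in>I. (g j l)\<^sup>2 / (b - lam l))"
    using g_col by (intro sum.cong refl) (simp add: power2_eq_square flip: sum_divide_distrib)
  also have "\<dots> = (\<Sum>j\<in>I. \<Sum>l\<in>I. (g j l)\<^sup>2 / (b - lam l))" by (rule sum.swap)
  also have "\<dots> = (\<Sum>j\<in>I. 1 / (b - lam' j) + (q j)\<^sup>2 / (1 + \<alpha>))"
  proof (intro sum.cong refl)
    fix j assume j: "j \<in> I"
    have split: "(Q * G + V * u) * G / (P * Q) = G\<^sup>2 / P + V / P * (G * (u / Q))"
      if "P \<noteq> 0" "Q \<noteq> 0" for P Q V G u :: real
      using that by (simp add: field_simps power2_eq_square)
    have "(\<Sum>l\<in>I. (g j l)\<^sup>2 / (b - lam l))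
        = (\<Sum>l\<in>I. (g j l)\<^sup>2 / (b - lam' j) + v' j / (b - lam' j) * (g j l * c l))"
    proof (intro sum.cong refl)
      fix l assume l: "l \<in> I"
      have "(g j l)\<^sup>2 / (b - lam l)
          = ((b - lam' j) * g j l) * g j l / ((b - lam' j) * (b - lam l))"
        using pos[OF j] by (simp add: power2_eq_square)
      also have "\<dots> = (g j l)\<^sup>2 / (b - lam' j) + v' j / (b - lam' j) * (g j l * c l)"
        unfolding rel[OF j l] c_def using pos[OF j] b[OF l] by (intro split) auto
      finally show "(g j l)\<^sup>2 / (b - lam l)
        = (g j l)\<^sup>2 / (b - lam' j) + v' j / (b - lam' j) * (g j l * c l)" .
    qed
    also have "\<dots> = 1 / (b - lam' j) + v' j / (b - lam' j) * q j"
      using g_row[OF j] by (simp add: sum.distrib q_def flip: sum_distrib_left sum_divide_distrib)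
    also have "v' j / (b - lam' j) = q j / (1 + \<alpha>)"
      using q[OF j] pos[OF j] \<open>\<alpha> \<ge> 0\<close> by (simp add: field_simps)
    finally show "(\<Sum>l\<in>I. (g j l)\<^sup>2 / (b - lam l)) = 1 / (b - lam' j) + (q j)\<^sup>2 / (1 + \<alpha>)"
      by (simp add: power2_eq_square)
  qed
  also have "\<dots> = (\<Sum>j\<in>I. 1 / (b - lam' j)) + (\<Sum>l\<in>I. (c l)\<^sup>2) / (1 + \<alpha>)"
    using qq by (simp add: sum.distrib flip: sum_divide_distrib)
  finally show "(\<Sum>j\<in>I. 1 / (b - lam' j)) = (\<Sum>l\<in>I. 1 / (b - lam l))
      - (\<Sum>l\<in>I. (vh l)\<^sup>2 / (b - lam l)\<^sup>2) / (1 + (\<Sum>l\<in>I. (vh l)\<^sup>2 / (b - lam l)))"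
    by (simp add: \<alpha>_def c_def power_divide)
qed

text \<open>With \<open>y l = lam l / (b - lam l)\<close> and \<open>r = 1 / (2 * A)\<close> one has
  \<open>b = b' * (1 + r)\<close> and \<open>x l = (1 + r) * y l + r * (x l * y l)\<close>. The
  linear part sums to at most \<open>(1 + r) * A = A + 1 / 2\<close>; the quadratic part is at most
  the last term of the bound, which a well-chosen pivot gains back.\<close>

lemma barrier_shift:
  fixes lam :: "'a \<Rightarrow> real"
  assumes I: "finite I" and A: "A > 0" and b: "b > 0"
    and lam: "\<And>l. l \<in> I \<Longrightarrow> 0 \<le> lam l \<and> lam l < b"
    and F: "(\<Sum>l\<in>I. lam l / (b - lam l)) \<le> A"
    and b'_def: "b' = b / (1 + 1 / (2 * A))"
  defines "x \<equiv> \<lambda>l. lam l / (b' - lam l)"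
  shows "\<And>l. l \<in> I \<Longrightarrow> lam l < b'"
    and "sum x I > 0 \<Longrightarrow> sum x I \<le> A + 1 / 2 + (\<Sum>l\<in>I. (x l)\<^sup>2) / sum x I"
proof -
  define y where "y l = lam l / (b - lam l)" for l
  define r where "r = 1 / (2 * A)"
  have r: "r > 0" using A by (simp add: r_def)
  have "1 + r \<noteq> 0" using r by simp
  then have b': "b' * (1 + r) = b" by (simp add: b'_def r_def)
  have b'0: "b' > 0" using b b' r by (metis add_pos_pos zero_less_mult_pos2 zero_less_one)
  have y0: "y l \<ge> 0" if "l \<in> I" for l using lam[OF that] by (simp add: y_def)
  \<comment> \<open>No single term exceeds the whole potential \<open>A\<close>. Hence
    \<open>1 - r * y l\<close> is at least 1/2, so the lowered barrier still lies above every
    eigenvalue.\<close>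
  have ry: "r * y l \<le> 1 / 2" if "l \<in> I" for l
  proof -
    have "y l \<le> A" using member_le_sum[OF that, of y] y0 I F by (force simp: y_def)
    then show ?thesis using A by (simp add: r_def field_simps)
  qed
  have lamy: "lam l * (1 + y l) = b * y l" if "l \<in> I" for l
    using lam[OF that] by (simp add: y_def field_simps)
  have gap: "(b' - lam l) * (1 + y l) = b' * (1 - r * y l)" if "l \<in> I" for l
  proof -
    have "(b' - lam l) * (1 + y l) = b' * (1 + y l) - b' * (1 + r) * y l"
      unfolding b' lamy[OF that, symmetric] by (simp add: left_diff_distrib)
    then show ?thesis by (simp add: algebra_simps)
  qed
  show less: "lam l < b'" if "l \<in> I" for l
  proof -
    have "0 < b' * (1 - r * y l)" using b'0 ry[OF that] by simp
    then have "0 < (b' - lam l) * (1 + y l)" using gap[OF that] by simp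
    then show ?thesis using y0[OF that] by (simp add: zero_less_mult_iff)
  qed
  have x0: "x l \<ge> 0" if "l \<in> I" for l using lam[OF that] less[OF that] by (simp add: x_def)
  have xy: "x l * (1 - r * y l) = (1 + r) * y l" if l: "l \<in> I" for l
  proof -
    have "b' * (x l * (1 - r * y l)) = x l * ((b' - lam l) * (1 + y l))"
      using gap[OF l] by simp
    also have "\<dots> = lam l * (1 + y l)" using less[OF l] by (simp add: x_def)
    also have "\<dots> = b' * ((1 + r) * y l)" unfolding lamy[OF l] b'[symmetric] by (simp only: mult.assoc)
    finally show ?thesis using b'0 by simp
  qed
  assume F1: "sum x I > 0"
  define Y where "Y = (\<Sum>l\<in>I. (x l)\<^sup>2)"
  have Y0: "Y \<ge> 0" by (simp add: Y_def sum_nonneg)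
  have sy: "sum y I \<le> A" using F by (simp add: y_def)
  \<comment> \<open>A crude bound on the new potential, used only to control the quadratic part of
    the exact identity below. Since 2 A = 1 / r, it becomes
    \<open>sum x I * r \<le> 1 + r\<close>.\<close>
  have "sum x I \<le> (\<Sum>l\<in>I. 2 * (1 + r) * y l)"
  proof (intro sum_mono)
    fix l assume l: "l \<in> I"
    have "x l * (1 / 2) \<le> x l * (1 - r * y l)" using x0[OF l] ry[OF l] by (intro mult_left_mono) auto
    then show "x l \<le> 2 * (1 + r) * y l" using xy[OF l] by (simp add: algebra_simps)
  qed
  also have "\<dots> = 2 * (1 + r) * sum y I" by (simp add: sum_distrib_left)
  also have "\<dots> \<le> 2 * (1 + r) * A" using sy r by (intro mult_left_mono) auto
  also have "\<dots> = (1 + r) / r" using A by (simp add: r_def)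
  finally have F1': "sum x I * r \<le> 1 + r" using r by (simp add: field_simps)
  have "(1 + r) * (\<Sum>l\<in>I. x l * y l) \<le> Y"
    unfolding Y_def sum_distrib_left
  proof (intro sum_mono)
    fix l assume l: "l \<in> I"
    have "x l * (1 - r * y l) \<le> x l * 1"
      using x0[OF l] y0[OF l] r by (intro mult_left_mono) auto
    then have "(1 + r) * y l \<le> x l" using xy[OF l] by simp
    then have "x l * ((1 + r) * y l) \<le> x l * x l" using x0[OF l] by (rule mult_left_mono)
    then show "(1 + r) * (x l * y l) \<le> (x l)\<^sup>2"
      by (simp add: power2_eq_square mult_ac)
  qed
  then have "sum x I * r * (\<Sum>l\<in>I. x l * y l) \<le> Y"
    using F1' x0 y0 by (meson mult_right_mono order_trans sum_nonneg mult_nonneg_nonneg)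
  then have e: "r * (\<Sum>l\<in>I. x l * y l) \<le> Y / sum x I" using F1 by (simp add: field_simps)
  have "sum x I = (\<Sum>l\<in>I. (1 + r) * y l + r * (x l * y l))"
    by (intro sum.cong refl) (use xy in \<open>simp add: algebra_simps\<close>)
  also have "\<dots> = (1 + r) * sum y I + r * (\<Sum>l\<in>I. x l * y l)"
    by (simp add: sum.distrib sum_distrib_left)
  also have "(1 + r) * sum y I \<le> (1 + r) * A" using sy r by (intro mult_left_mono) auto
  also have "(1 + r) * A = A + 1 / 2" using A by (simp add: r_def field_simps)
  finally show "sum x I \<le> A + 1 / 2 + (\<Sum>l\<in>I. (x l)\<^sup>2) / sum x I" using e by (simp add: Y_def)
qed

section \<open>Gaussian pivots and the choice of the pivot coordinate\<close>

text \<open>The Schur complement of the entry at \<open>(i, i)\<close>, kept on the full index set: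
  for \<open>K i i\<close> nonzero, row and column \<open>i\<close> become zero, and the index set
  stays the same through all steps.\<close>

definition pivot :: "('a \<Rightarrow> 'a \<Rightarrow> real) \<Rightarrow> 'a \<Rightarrow> 'a \<Rightarrow> 'a \<Rightarrow> real" where
  "pivot K i = (\<lambda>a c. K a c - K a i * K i c / K i i)"

text \<open>Pivoting minimizes the quadratic form over the \<open>i\<close>-th coordinate.\<close>

lemma bform_pivot:
  assumes I: "finite I" and i: "i \<in> I" and pos: "K i i > 0"
    and sym: "\<And>a c. a \<in> I \<Longrightarrow> c \<in> I \<Longrightarrow> K a c = K c a"
  shows "\<exists>\<alpha>. bform I (pivot K i) y y
    = bform I K (\<lambda>a. y a + \<alpha> * of_bool (a = i)) (\<lambda>a. y a + \<alpha> * of_bool (a = i))"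
proof -
  define e :: "'a \<Rightarrow> real" where "e a = of_bool (a = i)" for a
  define \<beta> where "\<beta> = (\<Sum>a\<in>I. K a i * y a)"
  define \<alpha> where "\<alpha> = - \<beta> / K i i"
  have "bform I K y e = (\<Sum>a\<in>I. \<Sum>c\<in>I. of_bool (c = i) * (K a c * y a))"
    by (simp add: bform_def e_def mult_ac)
  then have ye: "bform I K y e = \<beta>" using I i by (simp add: sum_of_bool_mult \<beta>_def)
  then have ey: "bform I K e y = \<beta>" using bform_commute[of I K e y, OF sym] by simp
  have "bform I K e e = (\<Sum>a\<in>I. of_bool (a = i) * (\<Sum>c\<in>I. of_bool (c = i) * K a c))"
    by (simp add: bform_def e_def mult_ac sum_distrib_left)
  then have ee: "bform I K e e = K i i" using I i by (simp add: sum_of_bool_mult)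
  have "bform I K (\<lambda>a. 1 * y a + \<alpha> * e a) (\<lambda>a. 1 * y a + \<alpha> * e a)
      = bform I K y y + 2 * \<alpha> * \<beta> + \<alpha>\<^sup>2 * K i i"
    unfolding bform_add_left bform_add_right ye ey ee by (simp add: power2_eq_square algebra_simps)
  also have "\<dots> = bform I K y y - \<beta> * \<beta> / K i i"
    using pos by (simp add: \<alpha>_def power2_eq_square field_simps)
  also have "\<beta> * \<beta> = (\<Sum>a\<in>I. \<Sum>c\<in>I. (K a i * y a) * (K i c * y c))"
    unfolding \<beta>_def sum_product using sym i by (intro sum.cong refl) simp
  also have "bform I K y y - \<dots> / K i i
      = (\<Sum>a\<in>I. \<Sum>c\<in>I. K a c * y a * y c - (K a i * y a) * (K i c * y c) / K i i)"
    by (simp add: bform_def sum_divide_distrib sum_subtractf)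
  also have "\<dots> = bform I (pivot K i) y y"
    unfolding bform_def pivot_def by (intro sum.cong refl) (simp add: left_diff_distrib right_diff_distrib mult_ac)
  finally show ?thesis by (intro exI[of _ \<alpha>]) (simp add: e_def)
qed

text \<open>With the barrier at \<open>b'\<close>, a pivot at \<open>i\<close> lowers the potential
  by \<open>P i / N i\<close>. The \<open>P i\<close> sum to the numerator and the
  \<open>N i\<close> to the denominator of the last term in \<open>barrier_shift\<close>, so some
  pivot gains at least that quotient and leaves at most \<open>A + 1 / 2\<close>.\<close>

lemma barrier_step:
  assumes I: "finite I" and K: "eigen_decomp I K lam w" and A: "A > 0" and b: "b > 0"
    and lam: "\<And>l. l \<in> I \<Longrightarrow> 0 \<le> lam l \<and> lam l < b"
    and F: "(\<Sum>l\<in>I. lam l / (b - lam l)) \<le> A"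
    and b'_def: "b' = b / (1 + 1 / (2 * A))"
  shows "\<exists>K' lam' w'. (K' = K \<or> (\<exists>i\<in>I. K i i > 0 \<and> K' = pivot K i)) \<and> eigen_decomp I K' lam' w' \<and>
    (\<forall>l\<in>I. 0 \<le> lam' l \<and> lam' l < b') \<and> (\<Sum>l\<in>I. lam' l / (b' - lam' l)) \<le> A + 1 / 2"
proof -
  have w: "orthogonal_on I w" using K by (simp add: eigen_decomp_def)
  define x where "x l = lam l / (b' - lam l)" for l
  have lamb': "lam l < b'" if "l \<in> I" for l
    using barrier_shift(1)[OF I A b lam F b'_def that] by simp
  have x0: "x l \<ge> 0" if "l \<in> I" for l using lam[OF that] lamb'[OF that] by (simp add: x_def)
  show ?thesis
  proof (cases "sum x I > 0")
    \<comment> \<open>A vanishing potential means that all eigenvalues are zero; then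
      \<open>K\<close> is kept without a pivot.\<close>
    case False
    then have "sum x I = 0" using x0 sum_nonneg[of I x] by force
    then have "\<And>l. l \<in> I \<Longrightarrow> x l = 0" using I x0 by (simp add: sum_nonneg_eq_0_iff)
    then have "\<And>l. l \<in> I \<Longrightarrow> lam l = 0" using lamb' by (force simp: x_def)
    then show ?thesis using K lamb' A by (intro exI[of _ K] exI[of _ lam] exI[of _ w]) auto
  next
    case True
    define Y where "Y = (\<Sum>l\<in>I. (x l)\<^sup>2)"
    \<comment> \<open>With X = K (b' - K)^(-1), \<open>N i\<close> and \<open>P i\<close> are the
      \<open>i\<close>-th diagonal entries of X and X^2, and \<open>Q i\<close> is that of K (b' -
      K)^(-1) K.\<close>
    define P where "P i = (\<Sum>l\<in>I. (x l)\<^sup>2 * (w l i)\<^sup>2)" for i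
    define N where "N i = (\<Sum>l\<in>I. x l * (w l i)\<^sup>2)" for i
    define Q where "Q i = (\<Sum>l\<in>I. (lam l * w l i)\<^sup>2 / (b' - lam l))" for i
    have bN: "K i i + Q i = b' * N i" if "i \<in> I" for i
    proof -
      have "K i i + Q i = (\<Sum>l\<in>I. lam l * (w l i)\<^sup>2 + (lam l * w l i)\<^sup>2 / (b' - lam l))"
        using K that by (simp add: eigen_decomp_def Q_def sum.distrib power2_eq_square mult.assoc)
      also have "\<dots> = b' * N i"
        unfolding N_def sum_distrib_left
      proof (intro sum.cong refl)
        fix l assume "l \<in> I"
        then show "lam l * (w l i)\<^sup>2 + (lam l * w l i)\<^sup>2 / (b' - lam l) = b' * (x l * (w l i)\<^sup>2)"
          using lamb'[of l] by (simp add: x_def field_simps power2_eq_square)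
      qed
      finally show ?thesis .
    qed
    have sw: "(\<Sum>i\<in>I. \<Sum>l\<in>I. c l * (w l i)\<^sup>2) = sum c I" for c
    proof -
      have "(\<Sum>i\<in>I. \<Sum>l\<in>I. c l * (w l i)\<^sup>2) = (\<Sum>l\<in>I. c l * (\<Sum>i\<in>I. w l i * w l i))"
        by (subst sum.swap) (simp add: sum_distrib_left power2_eq_square)
      then show ?thesis using w by (simp add: orthogonal_on_def)
    qed
    have Kd: "K i i = (\<Sum>l\<in>I. lam l * (w l i)\<^sup>2)" if "i \<in> I" for i
      using K that by (simp add: eigen_decomp_def power2_eq_square mult.assoc)
    have K0: "K i i \<ge> 0" if "i \<in> I" for i
      unfolding Kd[OF that] using lam by (intro sum_nonneg) simp
    \<comment> \<open>Averaging: summed over \<open>i\<close>, both sides give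
      \<open>Y * sum x I\<close>, so the reverse strict inequality cannot hold at every admissible
      pivot. Coordinates with \<open>K i i = 0\<close> contribute zero to both sums.\<close>
    have "\<exists>i\<in>I. K i i > 0 \<and> Y * N i \<le> sum x I * P i"
    proof (rule ccontr)
      assume "\<not> ?thesis"
      then have lt: "sum x I * P i < Y * N i" if "i \<in> I" "K i i > 0" for i using that by force
      have eq: "P i = 0 \<and> N i = 0" if i: "i \<in> I" "\<not> K i i > 0" for i
      proof -
        have "(\<Sum>l\<in>I. lam l * (w l i)\<^sup>2) = 0" using K0[of i] Kd[of i] i by simp
        then have "\<And>l. l \<in> I \<Longrightarrow> lam l * (w l i)\<^sup>2 = 0"
          using I lam by (simp add: sum_nonneg_eq_0_iff)
        then have "\<And>l. l \<in> I \<Longrightarrow> x l * w l i = 0" by (force simp: x_def)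
        then show ?thesis by (auto simp: P_def N_def intro!: sum.neutral)
      qed
      have "\<exists>i\<in>I. K i i > 0"
      proof (rule ccontr)
        assume "\<not> ?thesis"
        then have "sum N I = 0" using eq by (intro sum.neutral) auto
        then show False using sw[of x] True by (simp add: N_def)
      qed
      then have "(\<Sum>i\<in>I. sum x I * P i) < (\<Sum>i\<in>I. Y * N i)"
        using lt eq by (intro sum_strict_mono_ex1 I) (force intro: less_imp_le)+
      moreover have "(\<Sum>i\<in>I. sum x I * P i) = sum x I * Y"
        using sw[of "\<lambda>l. (x l)\<^sup>2"] by (simp add: P_def Y_def flip: sum_distrib_left)
      moreover have "(\<Sum>i\<in>I. Y * N i) = Y * sum x I"
        using sw[of x] by (simp add: N_def flip: sum_distrib_left)
      ultimately show False by simp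
    qed
    then obtain i where i: "i \<in> I" and Ki: "K i i > 0" and drop: "Y * N i \<le> sum x I * P i" by blast
    have sym: "K a c = K c a" if "a \<in> I" "c \<in> I" for a c
      by (rule eigen_decomp_commute[OF K that])
    define K' where "K' = pivot K i"
    have "K' a c = K' c a" if "a \<in> I" "c \<in> I" for a c
      using sym[OF that] sym[OF that(1) i] sym[OF that(2) i] by (simp add: K'_def pivot_def mult.commute)
    then obtain lam' w' where K': "eigen_decomp I K' lam' w'"
      using symmetric_diagonalizable[OF I, of K'] unfolding eigen_decomp_def by blast
    \<comment> \<open>Pivoting at \<open>i\<close> subtracts v v^T, where v is the
      \<open>i\<close>-th column of \<open>K\<close> divided by \<open>sqrt (K i i)\<close>. In the
      eigenbasis this column has coordinates \<open>lam l * w l i\<close>.\<close>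
    define v where "v a = K a i / sqrt (K i i)" for a
    have upd: "K' a c = K a c - v a * v c" if "a \<in> I" "c \<in> I" for a c
      using Ki sym[OF i that(2)] by (simp add: K'_def pivot_def v_def)
    have vh: "(\<Sum>a\<in>I. v a * w l a) = lam l * w l i / sqrt (K i i)" if "l \<in> I" for l
      using eigen_decomp_row[OF I K that i] by (simp add: v_def flip: sum_divide_distrib)
    note down = trace_resolvent_rank_one_downdate[OF I K K' upd lamb']
    have lam'b': "lam' l < b'" if "l \<in> I" for l using down(1) that by blast
    have "(\<Sum>l\<in>I. (\<Sum>a\<in>I. v a * w l a)\<^sup>2 / (b' - lam l)\<^sup>2) = P i / K i i"
      unfolding P_def sum_divide_distrib
      using Ki by (intro sum.cong refl) (simp add: vh x_def power_divide power_mult_distrib)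
    moreover have "(\<Sum>l\<in>I. (\<Sum>a\<in>I. v a * w l a)\<^sup>2 / (b' - lam l)) = Q i / K i i"
      unfolding Q_def sum_divide_distrib
      using Ki by (intro sum.cong refl) (simp add: vh power_divide power_mult_distrib)
    ultimately have "(\<Sum>j\<in>I. 1 / (b' - lam' j)) = (\<Sum>l\<in>I. 1 / (b' - lam l)) - P i / K i i / (1 + Q i / K i i)"
      using down(2) by simp
    \<comment> \<open>By \<open>bN\<close> the Sherman--Morrison denominator is a multiple of
      \<open>N i\<close>, and \<open>K i i\<close> cancels from the quotient.\<close>
    also have "1 + Q i / K i i = b' * N i / K i i" using bN[OF i] Ki by (simp add: field_simps)
    finally have tr: "(\<Sum>j\<in>I. 1 / (b' - lam' j)) = (\<Sum>l\<in>I. 1 / (b' - lam l)) - P i / (b' * N i)"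
      using Ki by simp
    have b'0: "b' > 0" using A b by (simp add: b'_def add_pos_pos)
    have "Q i \<ge> 0" unfolding Q_def using lamb' by (intro sum_nonneg) (simp add: less_imp_le)
    then have "b' * N i > 0" using bN[OF i] Ki by simp
    then have Npos: "N i > 0" using b'0 by (simp add: zero_less_mult_iff)
    \<comment> \<open>The potential is an affine function of the trace of the resolvent, with the
      same coefficients for \<open>K\<close> and \<open>K'\<close>, so the trace formula transfers
      to potentials.\<close>
    have resolvent: "(\<Sum>l\<in>I. u l / (b' - u l)) = b' * (\<Sum>l\<in>I. 1 / (b' - u l)) - real (card I)"
      if "\<And>l. l \<in> I \<Longrightarrow> u l < b'" for u
    proof -
      have "(\<Sum>l\<in>I. u l / (b' - u l)) = (\<Sum>l\<in>I. b' * (1 / (b' - u l)) - 1)"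
        using that by (intro sum.cong refl) (force simp: field_simps)
      then show ?thesis by (simp add: sum_subtractf sum_distrib_left)
    qed
    have "(\<Sum>l\<in>I. lam' l / (b' - lam' l)) = b' * (\<Sum>l\<in>I. 1 / (b' - lam' l)) - real (card I)"
      by (rule resolvent[OF lam'b'])
    also have "\<dots> = (b' * (\<Sum>l\<in>I. 1 / (b' - lam l)) - real (card I)) - P i / N i"
      unfolding tr using b'0 by (simp add: right_diff_distrib)
    also have "b' * (\<Sum>l\<in>I. 1 / (b' - lam l)) - real (card I) = sum x I"
      unfolding x_def by (rule resolvent[OF lamb', symmetric])
    also have "sum x I - P i / N i \<le> sum x I - Y / sum x I"
    proof -
      have "Y / sum x I \<le> P i / N i"
        using drop True Npos by (simp add: pos_divide_le_eq pos_le_divide_eq mult.commute)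
      then show ?thesis by simp
    qed
    also have "\<dots> \<le> A + 1 / 2"
      using barrier_shift(2)[OF I A b lam F b'_def] True by (simp add: x_def Y_def)
    finally have F': "(\<Sum>l\<in>I. lam' l / (b' - lam' l)) \<le> A + 1 / 2" .
    \<comment> \<open>Positive semidefiniteness survives the pivot: the new form at an eigenvector
      equals the form of \<open>K\<close> at a shifted vector.\<close>
    have "lam' l \<ge> 0" if "l \<in> I" for l
    proof -
      have "(\<Sum>a\<in>I. w' l a * w' l a) = 1" using K' that by (simp add: eigen_decomp_def orthogonal_on_def)
      then have "lam' l = bform I K' (w' l) (w' l)"
        using bform_eigenvector_left[OF I K' that] by simp
      also obtain z where "\<dots> = bform I K z z"
        using bform_pivot[of I i K, OF I i Ki sym] by (metis K'_def)
      also have "\<dots> \<ge> 0"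
        unfolding bform_eigen_decomp[OF K] using lam
        by (intro sum_nonneg) (simp add: mult.assoc)
      finally show ?thesis .
    qed
    then show ?thesis using i Ki K' F' lam'b' by (auto simp: K'_def)
  qed
qed

section \<open>Iterated elimination of coordinates\<close>

text \<open>The form of \<open>K\<close> bounds from above the minimum of the form of
  \<open>H\<close> over changes of the coordinates in \<open>\<tau>\<close>, that is, the Schur
  complement of \<open>H\<close>. In this variational form successive pivots compose without block
  matrices.\<close>

definition eliminates ::
    "'a set \<Rightarrow> ('a \<Rightarrow> 'a \<Rightarrow> real) \<Rightarrow> 'a set \<Rightarrow> ('a \<Rightarrow> 'a \<Rightarrow> real) \<Rightarrow> bool" where
  "eliminates I H \<tau> K \<longleftrightarrow> (\<forall>x. \<exists>z. (\<forall>a. a \<notin> \<tau> \<longrightarrow> z a = 0) \<and>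
    bform I H (\<lambda>a. x a + z a) (\<lambda>a. x a + z a) \<le> bform I K x x)"

lemma eliminates_empty: "eliminates I H {} H"
  unfolding eliminates_def by (intro allI exI[of _ "\<lambda>_. 0"]) simp

text \<open>The corrections add up: first the optimal shift of coordinate \<open>i\<close> for
  \<open>K\<close>, then the correction in \<open>\<tau>\<close> that \<open>K\<close> provides for
  the shifted vector.\<close>

lemma eliminates_pivot:
  assumes "finite I" "i \<in> I" "K i i > 0" "\<And>a c. a \<in> I \<Longrightarrow> c \<in> I \<Longrightarrow> K a c = K c a"
    and K: "eliminates I H \<tau> K"
  shows "eliminates I H (insert i \<tau>) (pivot K i)"
  unfolding eliminates_def
proof
  fix x
  obtain \<alpha> where \<alpha>: "bform I (pivot K i) x x
      = bform I K (\<lambda>a. x a + \<alpha> * of_bool (a = i)) (\<lambda>a. x a + \<alpha> * of_bool (a = i))"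
    using bform_pivot[of I i K x] assms(1-4) by blast
  obtain z where z: "\<forall>a. a \<notin> \<tau> \<longrightarrow> z a = 0"
    and le: "bform I H (\<lambda>a. x a + \<alpha> * of_bool (a = i) + z a) (\<lambda>a. x a + \<alpha> * of_bool (a = i) + z a)
      \<le> bform I (pivot K i) x x"
    using K[unfolded eliminates_def, rule_format, of "\<lambda>a. x a + \<alpha> * of_bool (a = i)"] \<alpha> by auto
  show "\<exists>z. (\<forall>a. a \<notin> insert i \<tau> \<longrightarrow> z a = 0) \<and>
      bform I H (\<lambda>a. x a + z a) (\<lambda>a. x a + z a) \<le> bform I (pivot K i) x x"
    using z le by (intro exI[of _ "\<lambda>a. \<alpha> * of_bool (a = i) + z a"]) (simp add: add.assoc)
qed

text \<open>Induction with \<open>barrier_step\<close> at \<open>A = 1 + k / 2\<close>: as 2 A = k +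
  2, the prescribed barrier ratio is (k + 2) / (k + 3), which 4 S / (k + 2) follows exactly. The
  size of \<open>\<tau>\<close> is only bounded by \<open>k\<close>, since a step may leave
  \<open>K\<close> unchanged.\<close>

lemma coordinate_elimination:
  assumes I: "finite I" and sym: "\<And>i j. i \<in> I \<Longrightarrow> j \<in> I \<Longrightarrow> H i j = H j i"
    and psd: "\<And>x. bform I H x x \<ge> 0" and S: "S = (\<Sum>i\<in>I. H i i)" "S > 0"
  shows "\<exists>\<tau> K lam w. \<tau> \<subseteq> I \<and> card \<tau> \<le> k \<and> eigen_decomp I K lam w \<and>
    (\<forall>l\<in>I. 0 \<le> lam l \<and> lam l < 4 * S / (real k + 2)) \<and>
    (\<Sum>l\<in>I. lam l / (4 * S / (real k + 2) - lam l)) \<le> 1 + real k / 2 \<and>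
    eliminates I H \<tau> K"
proof (induction k)
  case 0
  obtain lam w where H: "eigen_decomp I H lam w"
    using symmetric_diagonalizable[of I H, OF I sym] unfolding eigen_decomp_def by blast
  have w: "orthogonal_on I w" using H by (simp add: eigen_decomp_def)
  have lam0: "lam l \<ge> 0" if "l \<in> I" for l
  proof -
    have "(\<Sum>a\<in>I. w l a * w l a) = 1" using w that by (simp add: orthogonal_on_def)
    then show ?thesis using bform_eigenvector_left[OF I H that, of "w l"] psd[of "w l"] by simp
  qed
  have "S = (\<Sum>i\<in>I. \<Sum>l\<in>I. lam l * (w l i * w l i))"
    unfolding S using H by (intro sum.cong refl) (simp add: eigen_decomp_def mult.assoc)
  also have "\<dots> = (\<Sum>l\<in>I. lam l * (\<Sum>i\<in>I. w l i * w l i))"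
    by (subst sum.swap) (simp add: sum_distrib_left)
  also have "\<dots> = sum lam I" using w by (simp add: orthogonal_on_def)
  finally have tr: "sum lam I = S" by simp
  have le: "lam l \<le> S" if "l \<in> I" for l
    using member_le_sum[OF that, of lam] lam0 I tr by force
  \<comment> \<open>The initial barrier 2 S is twice the trace, and no eigenvalue exceeds S; every
    gap is at least S and the potential is at most tr H / S = 1.\<close>
  have "(\<Sum>l\<in>I. lam l / (2 * S - lam l)) \<le> (\<Sum>l\<in>I. lam l / S)"
  proof (intro sum_mono divide_left_mono)
    fix l assume "l \<in> I"
    then show "S \<le> 2 * S - lam l" "0 \<le> lam l" "0 < (2 * S - lam l) * S"
      using le[of l] lam0[of l] S(2) by auto
  qed
  also have "\<dots> = 1" using tr S by (simp flip: sum_divide_distrib)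
  finally have "(\<Sum>l\<in>I. lam l / (2 * S - lam l)) \<le> 1" .
  moreover have "lam l < 2 * S" if "l \<in> I" for l using le[OF that] S by simp
  ultimately show ?case
    using H lam0 by (intro exI[of _ "{}"] exI[of _ H] exI[of _ lam] exI[of _ w]) (auto simp: eliminates_empty)
next
  case (Suc k)
  then obtain \<tau> K lam w where \<tau>: "\<tau> \<subseteq> I" "card \<tau> \<le> k" and K: "eigen_decomp I K lam w"
    and lam: "\<And>l. l \<in> I \<Longrightarrow> 0 \<le> lam l \<and> lam l < 4 * S / (real k + 2)"
    and F: "(\<Sum>l\<in>I. lam l / (4 * S / (real k + 2) - lam l)) \<le> 1 + real k / 2"
    and elim: "eliminates I H \<tau> K"
    by blast
  define b' where "b' = 4 * S / (real (Suc k) + 2)"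
  have b': "b' = 4 * S / (real k + 2) / (1 + 1 / (2 * (1 + real k / 2)))"
  proof -
    have "2 * (1 + real k / 2) = real k + 2" by simp
    moreover have "1 + 1 / (real k + 2) = (real k + 3) / (real k + 2)" by (simp add: field_simps)
    ultimately show ?thesis by (simp add: b'_def add_ac)
  qed
  have "1 + real k / 2 > 0" "4 * S / (real k + 2) > 0" using S by (auto intro: add_pos_nonneg)
  from barrier_step[OF I K this lam F b'] obtain K' lam' w' where
    step: "K' = K \<or> (\<exists>i\<in>I. K i i > 0 \<and> K' = pivot K i)" and K': "eigen_decomp I K' lam' w'"
    and lam': "\<forall>l\<in>I. 0 \<le> lam' l \<and> lam' l < b'"
    and F': "(\<Sum>l\<in>I. lam' l / (b' - lam' l)) \<le> 1 + real k / 2 + 1 / 2" by blast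
  have "\<exists>\<tau>'\<subseteq>I. card \<tau>' \<le> Suc k \<and> eliminates I H \<tau>' K'"
    using step
  proof
    assume "K' = K"
    then show ?thesis using \<tau> elim by (intro exI[of _ \<tau>]) auto
  next
    assume "\<exists>i\<in>I. K i i > 0 \<and> K' = pivot K i"
    then obtain i where i: "i \<in> I" "K i i > 0" and K'_eq: "K' = pivot K i" by blast
    have "eliminates I H (insert i \<tau>) K'"
      unfolding K'_eq using I i eigen_decomp_commute[OF K] elim by (rule eliminates_pivot)
    moreover have "card (insert i \<tau>) \<le> Suc k"
      using \<tau>(2) card_insert_le_m1[of "Suc k" \<tau> i] by simp
    ultimately show ?thesis using \<tau> i by (intro exI[of _ "insert i \<tau>"]) auto
  qed
  then obtain \<tau>' where "\<tau>' \<subseteq> I" "card \<tau>' \<le> Suc k"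
    and "eliminates I H \<tau>' K'" by blast
  moreover have "(\<Sum>l\<in>I. lam' l / (b' - lam' l)) \<le> 1 + real (Suc k) / 2"
    using F' by (simp add: add_divide_distrib)
  ultimately show ?case
    using K' lam' unfolding b'_def[symmetric] by blast
qed

text \<open>All eigenvalues of the residual matrix lie below the final barrier, and Parseval turns
  this into a bound of its form by that multiple of the squared norm.\<close>

lemma ex_small_residual_coordinates:
  assumes I: "finite I" and sym: "\<And>i j. i \<in> I \<Longrightarrow> j \<in> I \<Longrightarrow> H i j = H j i"
    and psd: "\<And>x. bform I H x x \<ge> 0" and S: "S = (\<Sum>i\<in>I. H i i)" "S > 0"
  shows "\<exists>\<tau>\<subseteq>I. card \<tau> \<le> k \<and> (\<forall>x. \<exists>z. (\<forall>a. a \<notin> \<tau> \<longrightarrow> z a = 0) \<and>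
    bform I H (\<lambda>a. x a + z a) (\<lambda>a. x a + z a) \<le> 4 * S / (real k + 2) * (\<Sum>i\<in>I. (x i)\<^sup>2))"
proof -
  let ?b = "4 * S / (real k + 2)"
  obtain \<tau> K lam w where \<tau>: "\<tau> \<subseteq> I" "card \<tau> \<le> k" and K: "eigen_decomp I K lam w"
    and lam: "\<And>l. l \<in> I \<Longrightarrow> 0 \<le> lam l \<and> lam l < ?b"
    and elim: "eliminates I H \<tau> K"
    using coordinate_elimination[OF assms, of k] by blast
  have w: "orthogonal_on I w" using K by (simp add: eigen_decomp_def)
  have "bform I K x x \<le> ?b * (\<Sum>i\<in>I. (x i)\<^sup>2)" for x
  proof -
    have "bform I K x x \<le> (\<Sum>l\<in>I. ?b * ((\<Sum>i\<in>I. x i * w l i) * (\<Sum>i\<in>I. x i * w l i)))"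
      unfolding bform_eigen_decomp[OF K] mult.assoc
      using lam by (intro sum_mono mult_right_mono) (auto intro: less_imp_le)
    also have "\<dots> = ?b * (\<Sum>i\<in>I. (x i)\<^sup>2)"
      unfolding sum_distrib_left[symmetric] parseval[OF I w] by (simp add: power2_eq_square)
    finally show ?thesis .
  qed
  then show ?thesis
    using \<tau> elim unfolding eliminates_def by (meson order_trans)
qed

subsection \<open>Counting integer points\<close>

text \<open>Finiteness has to be secured before cardinalities are compared, because
  \<open>card\<close> is 0 on infinite sets.\<close>

lemma finite_bounded_integer_points:
  "finite {x \<in> Zn n. \<forall>j\<in>{1..n}. \<bar>x j\<bar> \<le> B}"
proof (rule finite_subset)
  let ?V = "{v \<in> \<int>. \<bar>v\<bar> \<le> (B::real)}"
  have "?V \<subseteq> of_int ` {-\<lceil>B\<rceil>..\<lceil>B\<rceil>}"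
  proof
    fix v assume v: "v \<in> ?V"
    then obtain k where k: "v = of_int k" by (auto elim: Ints_cases)
    then have "\<bar>k\<bar> \<le> \<lceil>B\<rceil>" using v by (simp add: le_ceiling_iff)
    then show "v \<in> of_int ` {-\<lceil>B\<rceil>..\<lceil>B\<rceil>}" using k by (auto simp: abs_le_iff minus_le_iff)
  qed
  then have "finite ?V" by (rule finite_subset) simp
  then show "finite {x. \<forall>j. (j \<in> {1..n} \<longrightarrow> x j \<in> ?V) \<and> (j \<notin> {1..n} \<longrightarrow> x j = 0)}"
    by (intro finite_set_of_finite_funs) auto
  show "{x \<in> Zn n. \<forall>j\<in>{1..n}. \<bar>x j\<bar> \<le> B}
      \<subseteq> {x. \<forall>j. (j \<in> {1..n} \<longrightarrow> x j \<in> ?V) \<and> (j \<notin> {1..n} \<longrightarrow> x j = 0)}"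
    by (auto simp: Zsub_def Rsub_def)
qed

lemma dilate_unit_ball:
  assumes "t > 0"
  shows "dilate t (unit_ball m) = {x \<in> Rn m. L2_set x {1..m} \<le> t}"
proof (intro set_eqI iffI)
  fix x assume "x \<in> dilate t (unit_ball m)"
  then obtain u where u: "u \<in> unit_ball m" "x = (\<lambda>j. t * u j)" by (auto simp: dilate_def)
  have "L2_set x {1..m} = t * L2_set u {1..m}"
    using assms unfolding u(2) by (intro L2_set_right_distrib[symmetric]) simp
  also have "\<dots> \<le> t" using u assms by (simp add: unit_ball_def)
  finally show "x \<in> {x \<in> Rn m. L2_set x {1..m} \<le> t}" using u by (auto simp: unit_ball_def Rsub_def)
next
  fix x assume x: "x \<in> {x \<in> Rn m. L2_set x {1..m} \<le> t}"
  have "L2_set (\<lambda>j. (1 / t) * x j) {1..m} = (1 / t) * L2_set x {1..m}"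
    using assms by (intro L2_set_right_distrib[symmetric]) simp
  also have "\<dots> \<le> 1" using x assms by simp
  finally have "(\<lambda>j. (1 / t) * x j) \<in> unit_ball m" using x by (auto simp: unit_ball_def Rsub_def)
  then show "x \<in> dilate t (unit_ball m)"
    unfolding dilate_def using assms by (intro image_eqI[of _ _ "\<lambda>j. (1 / t) * x j"]) auto
qed

lemma finite_d_count_set:
  assumes "t > 0" shows "finite (dilate t (unit_ball m) \<inter> Zn m)"
proof (rule finite_subset[OF _ finite_bounded_integer_points[of m t]])
  show "dilate t (unit_ball m) \<inter> Zn m \<subseteq> {x \<in> Zn m. \<forall>j\<in>{1..m}. \<bar>x j\<bar> \<le> t}"
    unfolding dilate_unit_ball[OF assms] using abs_le_L2_set by (fastforce intro: order_trans)
qed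

text \<open>The points with exactly \<open>k\<close> nonzero coordinates, all of them \<open>\<plusminus>1\<close>, have norm \<open>\<surd>k\<close>.\<close>

lemma binomial_le_d_count:
  assumes t: "t > 0" and k: "real k \<le> t\<^sup>2"
  shows "(m choose k) * 2 ^ k \<le> d_count t m"
proof -
  \<comment> \<open>A pair records the support of a sign vector and the part of it where the sign is
    +1.\<close>
  define X where "X = (SIGMA S : {S. S \<subseteq> {1..m} \<and> card S = k}. Pow S)"
  define f :: "nat set \<times> nat set \<Rightarrow> nat \<Rightarrow> real" where
    "f p j = (if j \<in> fst p then (if j \<in> snd p then 1 else -1) else 0)" for p j
  have "finite {S. S \<subseteq> {1..m} \<and> card S = k}" by (rule finite_subset[of _ "Pow {1..m}"]) auto
  then have "card X = (\<Sum>S\<in>{S. S \<subseteq> {1..m} \<and> card S = k}. card (Pow S))"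
    unfolding X_def by (subst card_SigmaI) (auto dest: finite_subset[OF _ finite_atLeastAtMost])
  also have "\<dots> = (\<Sum>S\<in>{S. S \<subseteq> {1..m} \<and> card S = k}. 2 ^ k)"
  proof (intro sum.cong refl)
    fix S assume "S \<in> {S. S \<subseteq> {1..m} \<and> card S = k}"
    then have "finite S" "card S = k" using finite_subset by blast+
    then show "card (Pow S) = 2 ^ k" by (simp add: card_Pow)
  qed
  also have "\<dots> = (m choose k) * 2 ^ k" using n_subsets[of "{1..m}" k] by simp
  finally have X: "card X = (m choose k) * 2 ^ k" .
  have "inj_on f X"
  proof (rule inj_onI)
    fix p q assume pq: "p \<in> X" "q \<in> X" "f p = f q"
    have fst: "fst p = {j. f p j \<noteq> 0}" for p by (auto simp: f_def)
    have snd: "snd p = {j. f p j = 1}" if "p \<in> X" for p using that by (auto simp: f_def X_def)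
    show "p = q" using fst[of p] fst[of q] snd[of p] snd[of q] pq by (simp add: prod_eq_iff)
  qed
  moreover have "f ` X \<subseteq> dilate t (unit_ball m) \<inter> Zn m"
  proof
    fix x assume "x \<in> f ` X"
    then obtain p where p: "p \<in> X" "x = f p" by blast
    have S: "fst p \<subseteq> {1..m}" "card (fst p) = k" using p by (auto simp: X_def)
    have "(\<Sum>i=1..m. (x i)\<^sup>2) = (\<Sum>i=1..m. if i \<in> fst p then 1 else 0)"
      by (intro sum.cong) (auto simp: p f_def)
    also have "\<dots> = real k" using S by (simp add: sum.If_cases Int_absorb1 Int_absorb2)
    finally have "L2_set x {1..m} = sqrt (real k)" by (simp add: L2_set_def)
    also have "\<dots> \<le> t" using k t by (simp add: real_le_lsqrt)
    finally show "x \<in> dilate t (unit_ball m) \<inter> Zn m"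
      unfolding dilate_unit_ball[OF t] using S by (auto simp: Zsub_def Rsub_def p f_def)
  qed
  ultimately show ?thesis
    using card_inj_on_le[OF _ _ finite_d_count_set[OF t]] X by (metis d_count_def)
qed

text \<open>Relabelling the coordinates in \<open>\<sigma>\<close> by \<open>{1..m}\<close>
  preserves norms and integrality, so it injects the integer points of the m-dimensional ball into
  the projection. The bound \<open>B\<close> makes the target finite.\<close>

lemma d_count_le_card_coord_proj:
  assumes t: "t > 0" and \<sigma>: "\<sigma> \<subseteq> {1..n}" "card \<sigma> = m"
    and E: "\<And>y. y \<in> Rsub \<sigma> \<Longrightarrow> L2_set y {1..n} \<le> t \<Longrightarrow> y \<in> coord_proj \<sigma> ` E"
    and bd: "\<And>x j. x \<in> E \<Longrightarrow> j \<in> {1..n} \<Longrightarrow> \<bar>x j\<bar> \<le> B"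
  shows "d_count t m \<le> card (coord_proj \<sigma> ` E \<inter> Zsub \<sigma>)"
proof -
  have fin: "finite \<sigma>" using \<sigma>(1) by (rule finite_subset) simp
  obtain h where h: "bij_betw h \<sigma> {1..m}"
    using finite_same_card_bij[OF fin, of "{1..m}"] \<sigma> by auto
  define f :: "(nat \<Rightarrow> real) \<Rightarrow> nat \<Rightarrow> real" where "f y j = (if j \<in> \<sigma> then y (h j) else 0)" for y j
  have "inj_on f (Zn m)"
  proof (rule inj_onI)
    fix x y assume xy: "x \<in> Zn m" "y \<in> Zn m" "f x = f y"
    show "x = y"
    proof
      fix j
      show "x j = y j"
      proof (cases "j \<in> {1..m}")
        case True
        then obtain i where "i \<in> \<sigma>" "h i = j" using h by (metis bij_betw_imp_surj_on imageE)
        then show ?thesis using fun_cong[OF xy(3), of i] by (simp add: f_def)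
      next
        case False
        then show ?thesis using xy by (simp add: Zsub_def Rsub_def)
      qed
    qed
  qed
  moreover have "f ` (dilate t (unit_ball m) \<inter> Zn m) \<subseteq> coord_proj \<sigma> ` E \<inter> Zsub \<sigma>"
  proof
    fix x assume "x \<in> f ` (dilate t (unit_ball m) \<inter> Zn m)"
    then obtain y where y: "y \<in> Zn m" "L2_set y {1..m} \<le> t" "x = f y"
      unfolding dilate_unit_ball[OF t] by auto
    have "(\<Sum>j=1..n. (x j)\<^sup>2) = (\<Sum>j\<in>\<sigma>. (y (h j))\<^sup>2)"
      using \<sigma> by (intro sum.mono_neutral_cong_right) (auto simp: y f_def)
    also have "\<dots> = (\<Sum>j=1..m. (y j)\<^sup>2)" using h by (rule sum.reindex_bij_betw)
    finally have "L2_set x {1..n} \<le> t" using y by (simp add: L2_set_def)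
    moreover have "x \<in> Zsub \<sigma>" using y by (auto simp: Zsub_def Rsub_def f_def)
    ultimately show "x \<in> coord_proj \<sigma> ` E \<inter> Zsub \<sigma>" using E by (auto simp: Zsub_def)
  qed
  moreover have "finite (coord_proj \<sigma> ` E \<inter> Zsub \<sigma>)"
  proof (rule finite_subset[OF _ finite_bounded_integer_points[of n B]])
    show "coord_proj \<sigma> ` E \<inter> Zsub \<sigma> \<subseteq> {x \<in> Zn n. \<forall>j\<in>{1..n}. \<bar>x j\<bar> \<le> B}"
    proof
      fix x assume x: "x \<in> coord_proj \<sigma> ` E \<inter> Zsub \<sigma>"
      then obtain u where u: "u \<in> E" "x = coord_proj \<sigma> u" by blast
      have "\<bar>x j\<bar> \<le> B" if "j \<in> {1..n}" for j
        using bd[OF u(1) that] abs_ge_zero[of "u j"] by (auto simp: u coord_proj_def)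
      then show "x \<in> {x \<in> Zn n. \<forall>j\<in>{1..n}. \<bar>x j\<bar> \<le> B}"
        using x \<sigma> by (auto simp: Zsub_def Rsub_def)
    qed
  qed
  ultimately show ?thesis
    unfolding d_count_def using card_inj_on_le[of f] inj_on_subset by (metis Int_lower2)
qed

subsection \<open>Second moments on the sphere\<close>

text \<open>A common source for sign flips and transpositions. As the signs agree along the orbits
  of the involution \<open>p\<close>, the map is its own inverse, which yields bijectivity at
  once.\<close>

lemma signed_involution_orthogonal:
  assumes p: "\<And>i. i \<in> {1..n} \<Longrightarrow> p i \<in> {1..n} \<and> p (p i) = i"
    and s: "\<And>i. i \<in> {1..n} \<Longrightarrow> s (p i) = s i \<and> (s i)\<^sup>2 = 1"
  defines "a \<equiv> \<lambda>i j. of_bool (p i = j) * s i"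
  shows "orthogonal_map n a" and "i \<in> {1..n} \<Longrightarrow> lin n a x i = s i * x (p i)"
proof -
  have lin: "lin n a x i = s i * x (p i)" if "i \<in> {1..n}" for x i
  proof -
    have "lin n a x i = (\<Sum>j\<in>{1..n}. of_bool (p i = j) * (s i * x j))"
      using that by (simp add: lin_def a_def mult_ac)
    then show ?thesis using p[OF that] by (simp only: sum_of_bool_mult finite_atLeastAtMost)
  qed
  have inv: "lin n a (lin n a x) = x" if "x \<in> Rn n" for x
  proof
    fix i
    show "lin n a (lin n a x) i = x i"
    proof (cases "i \<in> {1..n}")
      case True
      have "lin n a (lin n a x) i = s i * (s (p i) * x (p (p i)))"
        by (simp only: lin[OF True] lin[OF conjunct1[OF p[OF True]]])
      also have "\<dots> = (s i)\<^sup>2 * x i"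
        unfolding conjunct2[OF p[OF True]] conjunct1[OF s[OF True]] by (simp add: power2_eq_square)
      finally show ?thesis using s[OF True] by simp
    next
      case False
      then show ?thesis using that lin_Rn[of n a "lin n a x"] by (simp add: Rsub_def)
    qed
  qed
  have "bij_betw p {1..n} {1..n}"
    using p by (intro bij_betw_byWitness[of _ p]) auto
  then have "L2_set (lin n a x) {1..n} = L2_set x {1..n}" for x
    unfolding L2_set_def using s
    by (subst sum.reindex_bij_betw[symmetric, of p "{1..n}" "{1..n}"])
      (auto simp: lin power_mult_distrib intro!: sum.cong simp del: One_nat_def)
  moreover have "bij_betw (lin n a) (Rn n) (Rn n)"
    using inv lin_Rn by (intro bij_betw_byWitness[of _ "lin n a"]) auto
  ultimately show "orthogonal_map n a" by (simp add: orthogonal_map_def)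
  show "i \<in> {1..n} \<Longrightarrow> lin n a x i = s i * x (p i)" by (rule lin)
qed

section \<open>Integration over a sphere of fixed dimension\<close>

context
  fixes n :: nat
  assumes n: "n \<ge> 1"
begin

lemma sets_sphere_measure [measurable_cong]:
  "sets (sphere_measure n) = sets (restrict_space borel (unit_sphere n))"
  using rotation_invariant_prob_sphere_measure[OF n] by (simp add: rotation_invariant_prob_def)

lemma space_sphere_measure: "space (sphere_measure n) = unit_sphere n"
  using sets_eq_imp_space_eq[OF sets_sphere_measure] by (simp add: space_restrict_space)

lemma prob_space_sphere_measure: "prob_space (sphere_measure n)"
  using rotation_invariant_prob_sphere_measure[OF n] by (simp add: rotation_invariant_prob_def)

lemma measurable_sphere_measure:
  "f \<in> borel_measurable borel \<Longrightarrow> f \<in> borel_measurable (sphere_measure n)"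
  unfolding measurable_cong_sets[OF sets_sphere_measure refl] by (rule measurable_restrict_space1)

lemma sphere_integral_orthogonal:
  fixes f :: "(nat \<Rightarrow> real) \<Rightarrow> real"
  assumes a: "orthogonal_map n a" and f: "f \<in> borel_measurable borel"
  shows "(\<integral>x. f (lin n a x) \<partial>sphere_measure n) = (\<integral>x. f x \<partial>sphere_measure n)"
proof -
  let ?\<mu> = "sphere_measure n"
  have "lin n a x \<in> unit_sphere n" if "x \<in> unit_sphere n" for x
    using that orthogonal_L2[OF a] lin_Rn by (auto simp: unit_sphere_def)
  then have "lin n a \<in> restrict_space borel (unit_sphere n) \<rightarrow>\<^sub>M restrict_space borel (unit_sphere n)"
    by (intro measurable_restrict_space2)
      (auto simp: space_restrict_space intro!: measurable_restrict_space1)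
  then have lin: "lin n a \<in> ?\<mu> \<rightarrow>\<^sub>M ?\<mu>"
    by (simp add: measurable_cong_sets[OF sets_sphere_measure sets_sphere_measure])
  have "distr ?\<mu> ?\<mu> (lin n a) = ?\<mu>"
    using rotation_invariant_prob_sphere_measure[OF n] a by (simp add: rotation_invariant_prob_def)
  then have "(\<integral>x. f x \<partial>?\<mu>) = (\<integral>x. f x \<partial>distr ?\<mu> ?\<mu> (lin n a))" by simp
  also have "\<dots> = (\<integral>x. f (lin n a x) \<partial>?\<mu>)"
    by (rule integral_distr[OF lin measurable_sphere_measure[OF f]])
  finally show ?thesis by simp
qed

lemma integrable_sphere_coordinates:
  assumes "i \<in> {1..n}" "j \<in> {1..n}"
  shows "integrable (sphere_measure n) (\<lambda>x. x i * x j)"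
proof -
  interpret prob_space "sphere_measure n" by (rule prob_space_sphere_measure)
  have "norm (x i * x j) \<le> 1" if "x \<in> unit_sphere n" for x
    using abs_le_L2_set[OF assms(1), of x] abs_le_L2_set[OF assms(2), of x] that
    by (simp add: unit_sphere_def abs_mult mult_le_one)
  then show ?thesis
    by (intro integrable_const_bound[of _ 1] measurable_sphere_measure AE_I2)
      (auto simp: space_sphere_measure)
qed

text \<open>Flipping the sign of one coordinate negates a mixed moment, so it vanishes.
  Transpositions make the n diagonal moments equal, and they add up to the integral of the squared
  norm, which is 1.\<close>

lemma sphere_second_moments:
  assumes ij: "i \<in> {1..n}" "j \<in> {1..n}"
  shows "(\<integral>x. x i * x j \<partial>sphere_measure n) = of_bool (i = j) / real n"
proof (cases "i = j")
  case False
  define s :: "nat \<Rightarrow> real" where "s l = (if l = i then -1 else 1)" for l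
  have s: "(s l)\<^sup>2 = 1" for l by (simp add: s_def)
  note flip = signed_involution_orthogonal[of n "\<lambda>i. i" s, simplified s]
  let ?a = "\<lambda>k l. of_bool (k = l) * s k"
  have "(\<integral>x. x i * x j \<partial>sphere_measure n) = (\<integral>x. lin n ?a x i * lin n ?a x j \<partial>sphere_measure n)"
    using flip(1) by (intro sphere_integral_orthogonal[symmetric]) auto
  also have "(\<lambda>x. lin n ?a x i * lin n ?a x j) = (\<lambda>x. - (x i * x j))"
    using flip(2)[of i] flip(2)[of j] ij False by (simp add: s_def fun_eq_iff)
  finally show ?thesis using False by simp
next
  case True
  have eq: "(\<integral>x. x l * x l \<partial>sphere_measure n) = (\<integral>x. x i * x i \<partial>sphere_measure n)"
    if l: "l \<in> {1..n}" for l
  proof -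
    define p where "p = Transposition.transpose i l"
    have p: "p k \<in> {1..n} \<and> p (p k) = k" if "k \<in> {1..n}" for k
      using that ij l by (auto simp: p_def Transposition.transpose_def)
    note swap = signed_involution_orthogonal[of n p "\<lambda>_. 1", OF p, simplified]
    let ?a = "\<lambda>k l. of_bool (p k = l)"
    have "(\<integral>x. x i * x i \<partial>sphere_measure n) = (\<integral>x. lin n ?a x i * lin n ?a x i \<partial>sphere_measure n)"
      using swap(1) by (intro sphere_integral_orthogonal[symmetric]) auto
    also have "(\<lambda>x. lin n ?a x i * lin n ?a x i) = (\<lambda>x. x l * x l)"
      using swap(2)[of i] ij by (simp add: p_def fun_eq_iff)
    finally show ?thesis by simp
  qed
  interpret prob_space "sphere_measure n" by (rule prob_space_sphere_measure)
  have "real n * (\<integral>x. x i * x i \<partial>sphere_measure n) = (\<Sum>l=1..n. \<integral>x. x l * x l \<partial>sphere_measure n)"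
    using eq by simp
  also have "\<dots> = (\<integral>x. (\<Sum>l=1..n. x l * x l) \<partial>sphere_measure n)"
    by (intro Bochner_Integration.integral_sum[symmetric] integrable_sphere_coordinates) auto
  also have "\<dots> = (\<integral>x. 1 \<partial>sphere_measure n)"
    by (intro Bochner_Integration.integral_cong refl)
      (simp add: space_sphere_measure unit_sphere_def L2_set_def power2_eq_square)
  also have "\<dots> = 1" by (simp add: prob_space)
  finally show ?thesis using True n by (simp add: field_simps)
qed

end

subsection \<open>Ellipsoids\<close>

definition gram :: "nat \<Rightarrow> (nat \<Rightarrow> nat \<Rightarrow> real) \<Rightarrow> nat \<Rightarrow> nat \<Rightarrow> real" where
  "gram n T i j = (\<Sum>k=1..n. T k i * T k j)"

lemma bform_gram: "bform {1..n} (gram n T) x x = (L2_set (lin n T x) {1..n})\<^sup>2"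
proof -
  have "(L2_set (lin n T x) {1..n})\<^sup>2 = (\<Sum>k=1..n. (\<Sum>j=1..n. T k j * x j)\<^sup>2)"
    by (simp add: L2_set_def sum_nonneg lin_def)
  also have "\<dots> = (\<Sum>k=1..n. \<Sum>i=1..n. \<Sum>j=1..n. T k i * T k j * x i * x j)"
    by (simp add: power2_eq_square sum_product mult_ac)
  also have "\<dots> = (\<Sum>i=1..n. \<Sum>k=1..n. \<Sum>j=1..n. T k i * T k j * x i * x j)"
    by (rule sum.swap)
  also have "\<dots> = (\<Sum>i=1..n. \<Sum>j=1..n. \<Sum>k=1..n. T k i * T k j * x i * x j)"
    by (intro sum.cong refl sum.swap)
  also have "\<dots> = bform {1..n} (gram n T) x x"
    by (simp add: bform_def gram_def sum_distrib_right)
  finally show ?thesis by simp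
qed

text \<open>The columns of \<open>T\<close> are the preimages of the unit vectors. This gives a
  right inverse by linearity, and injectivity makes it a left inverse.\<close>

lemma lin_inverse_matrix:
  assumes bij: "bij_betw (lin n a) (Rn n) (Rn n)"
  obtains T where "\<And>x. x \<in> Rn n \<Longrightarrow> lin n a (lin n T x) = x"
    and "\<And>x. x \<in> Rn n \<Longrightarrow> lin n T (lin n a x) = x"
proof -
  define g where "g = inv_into (Rn n) (lin n a)"
  define e :: "nat \<Rightarrow> nat \<Rightarrow> real" where "e j i = of_bool (i = j)" for i j
  have e: "e j \<in> Rn n" if "j \<in> {1..n}" for j using that by (auto simp: e_def Rsub_def)
  have ge: "lin n a (g (e j)) = e j" if "j \<in> {1..n}" for j
    using bij e[OF that] unfolding g_def bij_betw_def by (metis f_inv_into_f)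
  define T where "T i j = g (e j) i" for i j
  have aT: "lin n a (lin n T x) = x" if x: "x \<in> Rn n" for x
  proof
    fix i
    show "lin n a (lin n T x) i = x i"
    proof (cases "i \<in> {1..n}")
      case True
      have "lin n a (lin n T x) i = (\<Sum>k=1..n. \<Sum>j=1..n. a i k * T k j * x j)"
        using True by (simp add: lin_def sum_distrib_left mult_ac)
      also have "\<dots> = (\<Sum>j=1..n. \<Sum>k=1..n. a i k * T k j * x j)" by (rule sum.swap)
      also have "\<dots> = (\<Sum>j\<in>{1..n}. of_bool (i = j) * x j)"
      proof (intro sum.cong refl)
        fix j assume j: "j \<in> {1..n}"
        have "(\<Sum>k=1..n. a i k * T k j) = lin n a (g (e j)) i" using True by (simp add: lin_def T_def)
        also have "\<dots> = of_bool (i = j)" unfolding ge[OF j] by (simp add: e_def)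
        finally show "(\<Sum>k=1..n. a i k * T k j * x j) = of_bool (i = j) * x j"
          by (simp flip: sum_distrib_right)
      qed
      also have "\<dots> = x i" using True by (simp only: sum_of_bool_mult finite_atLeastAtMost)
      finally show ?thesis .
    next
      case False
      then show ?thesis using x lin_Rn[of n a "lin n T x"] by (simp add: Rsub_def)
    qed
  qed
  moreover have "lin n T (lin n a x) = x" if "x \<in> Rn n" for x
    using bij aT[OF lin_Rn[of n a x]] that lin_Rn unfolding bij_betw_def inj_on_def by blast
  ultimately show ?thesis by (rule that)
qed

text \<open>For \<open>t > 0\<close> the dilate of the ellipsoid by \<open>t\<close> consists of the
  points whose image under \<open>T\<close> has norm at most \<open>t\<close>.\<close>

lemma gauge_norm_ellipsoid:
  assumes aT: "\<And>x. x \<in> Rn n \<Longrightarrow> lin n a (lin n T x) = x"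
    and Ta: "\<And>x. x \<in> Rn n \<Longrightarrow> lin n T (lin n a x) = x" and x: "x \<in> Rn n"
  shows "gauge_norm (lin n a ` unit_ball n) x = L2_set (lin n T x) {1..n}"
proof -
  have lin_scale: "lin n b (\<lambda>j. t * u j) = (\<lambda>j. t * lin n b u j)" for b t u
    by (auto simp: lin_def sum_distrib_left mult_ac)
  have "x \<in> dilate t (lin n a ` unit_ball n) \<longleftrightarrow> L2_set (lin n T x) {1..n} \<le> t" if t: "t > 0" for t
  proof -
    have "dilate t (lin n a ` unit_ball n) = lin n a ` dilate t (unit_ball n)"
      by (auto simp: dilate_def image_image lin_scale)
    also have "x \<in> \<dots> \<longleftrightarrow> lin n T x \<in> dilate t (unit_ball n)"
    proof
      assume "x \<in> lin n a ` dilate t (unit_ball n)"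
      then show "lin n T x \<in> dilate t (unit_ball n)"
        using Ta unfolding dilate_unit_ball[OF t] by auto
    next
      assume "lin n T x \<in> dilate t (unit_ball n)"
      then show "x \<in> lin n a ` dilate t (unit_ball n)" by (rule rev_image_eqI) (simp add: aT[OF x])
    qed
    finally show ?thesis using lin_Rn by (simp add: dilate_unit_ball[OF t])
  qed
  then have "gauge_norm (lin n a ` unit_ball n) x = Inf {t. 0 < t \<and> L2_set (lin n T x) {1..n} \<le> t}"
    unfolding gauge_norm_def by (intro arg_cong[where f = Inf]) auto
  also have "\<dots> = L2_set (lin n T x) {1..n}"
  proof (cases "L2_set (lin n T x) {1..n} = 0")
    \<comment> \<open>The condition \<open>0 < t\<close> leaves an open ray here, whose infimum 0 is
      not attained.\<close>
    case True
    then have "{t. 0 < t \<and> L2_set (lin n T x) {1..n} \<le> t} = {0<..}" by auto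
    then show ?thesis using True by simp
  next
    case False
    then have "L2_set (lin n T x) {1..n} > 0" using L2_set_nonneg[of "lin n T x" "{1..n}"] by linarith
    then have "{t. 0 < t \<and> L2_set (lin n T x) {1..n} \<le> t} = {L2_set (lin n T x) {1..n}..}" by auto
    then show ?thesis by simp
  qed
  finally show ?thesis .
qed

text \<open>The squared gauge is the quadratic form of the Gram matrix; by the second moments only
  its diagonal survives integration, with weight 1 / n.\<close>

lemma M_ell_ellipsoid:
  assumes n: "n \<ge> 1" and aT: "\<And>x. x \<in> Rn n \<Longrightarrow> lin n a (lin n T x) = x"
    and Ta: "\<And>x. x \<in> Rn n \<Longrightarrow> lin n T (lin n a x) = x"
  shows "(M_ell n (lin n a ` unit_ball n))\<^sup>2 = (\<Sum>i=1..n. gram n T i i) / real n"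
proof -
  let ?E = "lin n a ` unit_ball n"
  have "(M_ell n ?E)\<^sup>2 = (\<integral>x. (gauge_norm ?E x)\<^sup>2 \<partial>sphere_measure n)"
    by (simp add: M_ell_def)
  also have "\<dots> = (\<integral>x. (\<Sum>i=1..n. \<Sum>j=1..n. gram n T i j * (x i * x j)) \<partial>sphere_measure n)"
  proof (intro Bochner_Integration.integral_cong refl)
    fix x assume "x \<in> space (sphere_measure n)"
    then have "x \<in> Rn n" using space_sphere_measure[OF n] by (simp add: unit_sphere_def)
    then show "(gauge_norm ?E x)\<^sup>2 = (\<Sum>i=1..n. \<Sum>j=1..n. gram n T i j * (x i * x j))"
      using gauge_norm_ellipsoid[OF aT Ta] bform_gram[of n T x] by (simp add: bform_def mult.assoc)
  qed
  also have "\<dots> = (\<Sum>i=1..n. \<Sum>j=1..n. gram n T i j * (\<integral>x. x i * x j \<partial>sphere_measure n))"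
  proof -
    have int: "integrable (sphere_measure n) (\<lambda>x. gram n T i j * (x i * x j))"
      if "i \<in> {1..n}" "j \<in> {1..n}" for i j
      using integrable_sphere_coordinates[OF n that] by (rule integrable_mult_right)
    have "(\<integral>x. (\<Sum>i=1..n. \<Sum>j=1..n. gram n T i j * (x i * x j)) \<partial>sphere_measure n)
        = (\<Sum>i=1..n. \<integral>x. (\<Sum>j=1..n. gram n T i j * (x i * x j)) \<partial>sphere_measure n)"
      by (intro Bochner_Integration.integral_sum Bochner_Integration.integrable_sum int)
    also have "\<dots> = (\<Sum>i=1..n. \<Sum>j=1..n. \<integral>x. gram n T i j * (x i * x j) \<partial>sphere_measure n)"
      by (intro sum.cong refl Bochner_Integration.integral_sum int)
    finally show ?thesis by simp
  qed
  also have "\<dots> = (\<Sum>i=1..n. \<Sum>j\<in>{1..n}. of_bool (i = j) * (gram n T i j / real n))"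
    using sphere_second_moments[OF n] by (intro sum.cong refl) simp
  also have "\<dots> = (\<Sum>i=1..n. gram n T i i) / real n"
    unfolding sum_divide_distrib
    by (intro sum.cong refl) (simp only: sum_of_bool_mult finite_atLeastAtMost)
  finally show ?thesis .
qed

text \<open>The trace is the sum of the squared entries of \<open>T\<close>; if it were 0, then
  \<open>T\<close> would vanish and could not be inverted on the first unit vector.\<close>

lemma trace_gram_pos:
  assumes n: "n \<ge> 1" and aT: "\<And>x. x \<in> Rn n \<Longrightarrow> lin n a (lin n T x) = x"
  shows "(\<Sum>i=1..n. gram n T i i) > 0"
proof (rule ccontr)
  have nn: "gram n T i i \<ge> 0" for i by (simp add: gram_def sum_nonneg)
  assume "\<not> ?thesis"
  then have "(\<Sum>i=1..n. gram n T i i) = 0" using sum_nonneg[of "{1..n}" "\<lambda>i. gram n T i i"] nn by force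
  then have "gram n T i i = 0" if "i \<in> {1..n}" for i
    using nn that by (simp add: sum_nonneg_eq_0_iff)
  then have T0: "T k i = 0" if "i \<in> {1..n}" "k \<in> {1..n}" for i k
    using that by (simp add: gram_def sum_nonneg_eq_0_iff)
  define e :: "nat \<Rightarrow> real" where "e i = of_bool (i = 1)" for i
  have "e \<in> Rn n" using n by (auto simp: e_def Rsub_def)
  then have "lin n a (lin n T e) 1 = 1" using aT by (simp add: e_def)
  moreover have "lin n T e = (\<lambda>_. 0)" using T0 by (auto simp: lin_def intro!: sum.neutral)
  moreover have "lin n a (\<lambda>_. 0) 1 = 0" by (simp add: lin_def)
  ultimately show False by simp
qed

lemma ellipsoid_bounded:
  assumes "x \<in> lin n a ` unit_ball n" "j \<in> {1..n}"
  shows "\<bar>x j\<bar> \<le> (\<Sum>i=1..n. \<Sum>k=1..n. \<bar>a i k\<bar>)"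
proof -
  obtain u where u: "x = lin n a u" "u \<in> unit_ball n" using assms by blast
  have "\<bar>x j\<bar> \<le> (\<Sum>k=1..n. \<bar>a j k * u k\<bar>)" using assms by (simp add: u lin_def)
  also have "\<dots> \<le> (\<Sum>k=1..n. \<bar>a j k\<bar>)"
  proof (rule sum_mono)
    fix k assume "k \<in> {1..n}"
    then have "\<bar>u k\<bar> \<le> 1" using abs_le_L2_set[of k n u] u by (simp add: unit_ball_def)
    then show "\<bar>a j k * u k\<bar> \<le> \<bar>a j k\<bar>" by (simp add: abs_mult mult_left_le)
  qed
  also have "\<dots> \<le> (\<Sum>i=1..n. \<Sum>k=1..n. \<bar>a i k\<bar>)"
    using assms(2) by (intro member_le_sum[of j "{1..n}" "\<lambda>i. \<Sum>k=1..n. \<bar>a i k\<bar>"]) (auto intro: sum_nonneg)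
  finally show ?thesis .
qed

section \<open>From a small residual form to a ball inside a coordinate projection\<close>

text \<open>A point \<open>y\<close> of the coordinate subspace is lifted by the correction
  \<open>z\<close>, supported on the eliminated coordinates. The lift still projects to
  \<open>y\<close>, and its gauge norm is controlled by the residual bound after n - m
  steps.\<close>

lemma coord_proj_ellipsoid_contains_ball:
  fixes \<theta> :: real
  assumes n: "n \<ge> 1" and E: "E = lin n a ` unit_ball n" and m: "m \<le> n" "\<theta> > 0" "\<theta> * real n \<le> real (n - m)"
    and aT: "\<And>x. x \<in> Rn n \<Longrightarrow> lin n a (lin n T x) = x"
    and Ta: "\<And>x. x \<in> Rn n \<Longrightarrow> lin n T (lin n a x) = x"
  obtains \<sigma> where "\<sigma> \<subseteq> {1..n}" "card \<sigma> = m"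
    and "\<And>y. y \<in> Rsub \<sigma> \<Longrightarrow> 4 * (M_ell n E)\<^sup>2 * (L2_set y {1..n})\<^sup>2 \<le> \<theta> \<Longrightarrow> y \<in> coord_proj \<sigma> ` E"
proof -
  let ?I = "{1..n}" and ?H = "gram n T"
  define S where "S = (\<Sum>i=1..n. ?H i i)"
  have S: "S > 0" unfolding S_def using n aT by (rule trace_gram_pos)
  have "(M_ell n E)\<^sup>2 = S / real n" unfolding E S_def using n aT Ta by (rule M_ell_ellipsoid)
  then have SM: "S = real n * (M_ell n E)\<^sup>2" using n by simp
  obtain \<tau> where \<tau>: "\<tau> \<subseteq> ?I" "card \<tau> \<le> n - m"
    and res: "\<And>x. \<exists>z. (\<forall>a. a \<notin> \<tau> \<longrightarrow> z a = 0) \<and>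
      bform ?I ?H (\<lambda>a. x a + z a) (\<lambda>a. x a + z a) \<le> 4 * S / (real (n - m) + 2) * (\<Sum>i\<in>?I. (x i)\<^sup>2)"
  proof -
    have "?H i j = ?H j i" for i j by (simp add: gram_def mult.commute)
    moreover have "bform ?I ?H x x \<ge> 0" for x unfolding bform_gram by simp
    ultimately show ?thesis
      using that ex_small_residual_coordinates[of ?I ?H S "n - m"] S finite_atLeastAtMost S_def by blast
  qed
  \<comment> \<open>Fewer than n - m coordinates may have been eliminated, so
    \<open>\<sigma>\<close> is cut down to exactly \<open>m\<close> of the remaining ones.\<close>
  have "m \<le> card (?I - \<tau>)" using \<tau> m by (simp add: card_Diff_subset finite_subset)
  then obtain \<sigma> where \<sigma>: "\<sigma> \<subseteq> ?I - \<tau>" "card \<sigma> = m" by (metis obtain_subset_with_card_n)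
  have "y \<in> coord_proj \<sigma> ` E"
    if y: "y \<in> Rsub \<sigma>" and small: "4 * (M_ell n E)\<^sup>2 * (L2_set y {1..n})\<^sup>2 \<le> \<theta>" for y
  proof -
    obtain z where z: "\<And>a. a \<notin> \<tau> \<Longrightarrow> z a = 0"
      and le: "bform ?I ?H (\<lambda>a. y a + z a) (\<lambda>a. y a + z a)
        \<le> 4 * S / (real (n - m) + 2) * (\<Sum>i\<in>?I. (y i)\<^sup>2)" using res by blast
    define u where "u = (\<lambda>a. y a + z a)"
    have "u j = 0" if "j \<notin> ?I" for j
    proof -
      have "j \<notin> \<sigma>" "j \<notin> \<tau>" using that \<sigma> \<tau> by blast+
      then show ?thesis using y z by (simp add: u_def Rsub_def)
    qed
    then have u: "u \<in> Rn n" by (simp add: Rsub_def)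
    have "(\<Sum>i\<in>?I. (y i)\<^sup>2) = (L2_set y ?I)\<^sup>2" by (simp add: L2_set_def sum_nonneg)
    then have "(L2_set (lin n T u) ?I)\<^sup>2 \<le> 4 * S / (real (n - m) + 2) * (L2_set y ?I)\<^sup>2"
      using le unfolding u_def bform_gram by simp
    also have "\<dots> = real n * (4 * (M_ell n E)\<^sup>2 * (L2_set y ?I)\<^sup>2) / (real (n - m) + 2)"
      by (simp add: SM)
    also have "\<dots> \<le> real n * \<theta> / (real (n - m) + 2)"
      using small by (intro divide_right_mono mult_left_mono) auto
    \<comment> \<open>The hypothesis on \<open>m\<close> makes the numerator at most n - m.\<close>
    also have "\<dots> \<le> 1" using m by (simp add: mult.commute of_nat_diff)
    finally have "L2_set (lin n T u) ?I \<le> 1" by (simp add: power_le_one_iff L2_set_nonneg abs_square_le_1)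
    then have "lin n T u \<in> unit_ball n" using lin_Rn by (simp add: unit_ball_def)
    then have "u \<in> E" unfolding E using aT[OF u] by (metis imageI)
    moreover have "coord_proj \<sigma> u = y" using y z \<sigma> by (auto simp: coord_proj_def u_def Rsub_def fun_eq_iff)
    ultimately show ?thesis by blast
  qed
  then show ?thesis using \<sigma> by (intro that[of \<sigma>]) auto
qed

section \<open>The integer point estimates with c = 1/4\<close>

theorem mainTheorem8:
  shows "\<exists>c::real. c > 0 \<and>
    (\<forall>(n::nat) (E :: (nat \<Rightarrow> real) set) (\<theta>::real).
      n \<ge> 1 \<and> ellipsoid n E \<and> 0 < \<theta> \<and> \<theta> < 1 \<longrightarrow>
      (let m = nat \<lfloor>(1 - \<theta>) * real n\<rfloor>;
           t = c * sqrt \<theta> / (sqrt (ln (2 / \<theta>)) * M_ell n E);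
           k = nat \<lfloor>c\<^sup>2 * \<theta> / (ln (2 / \<theta>) * (M_ell n E)\<^sup>2)\<rfloor>
       in \<exists>\<sigma>. \<sigma> \<subseteq> {1..n} \<and> card \<sigma> = m \<and>
            card (coord_proj \<sigma> ` E \<inter> Zsub \<sigma>) \<ge> d_count t m \<and>
            d_count t m \<ge> (m choose k) * 2 ^ k))"
proof (intro exI[of _ "1 / 4"] conjI allI impI)
  fix n :: nat and E :: "(nat \<Rightarrow> real) set" and \<theta> :: real
  assume "n \<ge> 1 \<and> ellipsoid n E \<and> 0 < \<theta> \<and> \<theta> < 1"
  then have n: "n \<ge> 1" and ell: "ellipsoid n E" and \<theta>: "0 < \<theta>" "\<theta> < 1" by auto
  obtain a where bij: "bij_betw (lin n a) (Rn n) (Rn n)" and E: "E = lin n a ` unit_ball n"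
    using ell unfolding ellipsoid_def by blast
  obtain T where aT: "\<And>x. x \<in> Rn n \<Longrightarrow> lin n a (lin n T x) = x"
    and Ta: "\<And>x. x \<in> Rn n \<Longrightarrow> lin n T (lin n a x) = x" using lin_inverse_matrix[OF bij] by blast
  define m where "m = nat \<lfloor>(1 - \<theta>) * real n\<rfloor>"
  define M where "M = M_ell n E"
  define t where "t = 1 / 4 * sqrt \<theta> / (sqrt (ln (2 / \<theta>)) * M)"
  define k where "k = nat \<lfloor>(1 / 4)\<^sup>2 * \<theta> / (ln (2 / \<theta>) * M\<^sup>2)\<rfloor>"
  have "M\<^sup>2 > 0"
    using M_ell_ellipsoid[OF n aT Ta] trace_gram_pos[OF n aT] n by (simp add: M_def E)
  moreover have "M \<ge> 0" by (simp add: M_def M_ell_def)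
  ultimately have M: "M > 0" by (simp add: less_le)
  have "ln 2 \<le> ln (2 / \<theta>)" using \<theta> by (simp add: field_simps)
  then have L: "ln (2 / \<theta>) \<ge> 2 / 3" using ln2_ge_two_thirds by linarith
  have t: "t > 0" using L M \<theta> by (simp add: t_def)
  have t2: "t\<^sup>2 = (1 / 4)\<^sup>2 * \<theta> / (ln (2 / \<theta>) * M\<^sup>2)"
    using L \<theta> by (simp add: t_def power_divide power_mult_distrib)
  have "real m \<le> (1 - \<theta>) * real n" using \<theta> by (simp add: m_def)
  \<comment> \<open>Rounding (1 - \<theta>) n down leaves at least \<theta> n coordinates outside
    \<open>\<sigma>\<close>.\<close>
  then have m: "m \<le> n" "\<theta> * real n \<le> real (n - m)" using \<theta>
    by (simp_all add: algebra_simps) (metis add.commute add_increasing less_imp_le mult_nonneg_nonneg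
      of_nat_0_le_iff of_nat_le_iff order_trans le_add_same_cancel1)
  obtain \<sigma> where \<sigma>: "\<sigma> \<subseteq> {1..n}" "card \<sigma> = m"
    and ball: "\<And>y. y \<in> Rsub \<sigma> \<Longrightarrow> 4 * M\<^sup>2 * (L2_set y {1..n})\<^sup>2 \<le> \<theta> \<Longrightarrow> y \<in> coord_proj \<sigma> ` E"
    using coord_proj_ellipsoid_contains_ball[OF n E m(1) \<theta>(1) m(2) aT Ta] unfolding M_def by blast
  have "d_count t m \<le> card (coord_proj \<sigma> ` E \<inter> Zsub \<sigma>)"
  proof (rule d_count_le_card_coord_proj[OF t \<sigma>])
    fix y assume y: "y \<in> Rsub \<sigma>" "L2_set y {1..n} \<le> t"
    have "4 * M\<^sup>2 * (L2_set y {1..n})\<^sup>2 \<le> 4 * M\<^sup>2 * t\<^sup>2"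
      using y by (intro mult_left_mono power_mono) (auto simp: L2_set_nonneg)
    \<comment> \<open>The choice c = 1/4 is used here: 4 c^2 = 1/4 lies below 2/3, which bounds ln
      (2 / \<theta>) from below, so the ball of radius \<open>t\<close> fits into the
      projection.\<close>
    also have "\<dots> = \<theta> / (4 * ln (2 / \<theta>))" unfolding t2 using M by (simp add: power2_eq_square)
    also have "\<dots> \<le> \<theta>" using L \<theta> by (simp add: divide_le_eq)
    finally show "y \<in> coord_proj \<sigma> ` E" using ball y by blast
  next
    show "\<bar>x j\<bar> \<le> (\<Sum>i=1..n. \<Sum>k=1..n. \<bar>a i k\<bar>)" if "x \<in> E" "j \<in> {1..n}" for x j
      using ellipsoid_bounded that unfolding E by blast
  qed
  \<comment> \<open>By \<open>t2\<close>, \<open>k\<close> is the integer part of t^2, so sign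
    vectors with \<open>k\<close> nonzero entries have norm at most \<open>t\<close>.\<close>
  moreover have "(m choose k) * 2 ^ k \<le> d_count t m"
    using t by (rule binomial_le_d_count) (simp add: k_def t2[symmetric])
  ultimately show "let m = nat \<lfloor>(1 - \<theta>) * real n\<rfloor>;
           t = 1 / 4 * sqrt \<theta> / (sqrt (ln (2 / \<theta>)) * M_ell n E);
           k = nat \<lfloor>(1 / 4)\<^sup>2 * \<theta> / (ln (2 / \<theta>) * (M_ell n E)\<^sup>2)\<rfloor>
       in \<exists>\<sigma>. \<sigma> \<subseteq> {1..n} \<and> card \<sigma> = m \<and>
            card (coord_proj \<sigma> ` E \<inter> Zsub \<sigma>) \<ge> d_count t m \<and>
            d_count t m \<ge> (m choose k) * 2 ^ k"
    unfolding Let_def m_def[symmetric] M_def[symmetric] t_def[symmetric] k_def[symmetric]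
    using \<sigma> by blast
qed simp

end
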